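(* There exists an infinite connected graph $G$ such that every vertex of $G$ has degree $3$, every end of $G$ has vertex-degree $3$ and edge-degree $3$, and $|G|$ contains exactly one Hamilton circle.
   Context: All graphs are simple. An end of a graph is an equivalence class of rays (one-way infinite paths), two rays being equivalent if no finite vertex set separates them. The vertex-degree (resp. edge-degree) of an end $\omega$ is the supremum of the number of vertex-disjoint (resp. edge-disjoint) rays in $\omega$. For a locally finite connected graph $G$, $|G|$ is its Freudenthal compactification ($G$ as a 1-complex plus its ends, where for each finite $S\subseteq V(G)$ the component of $G-S$ containing tails of the rays of an end, together with its ends and inner points of edges to $S$, is an open neighbourhood of that end). A Hamilton circle is a homeomorphic image of $S^1$ in $|G|$ containing all vertices of $G$. *)

theory Defs
  imports "HOL-Analysis.Analysis" "HOL-Library.Extended_Nat"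
begin

text \<open>Simple graphs on the vertex set UNIV :: nat set, given by a symmetric
irreflexive adjacency relation E.\<close>

definition simple_graph :: "(nat \<Rightarrow> nat \<Rightarrow> bool) \<Rightarrow> bool" where
  "simple_graph E \<longleftrightarrow> (\<forall>u v. E u v \<longrightarrow> E v u) \<and> (\<forall>v. \<not> E v v)"

definition graph_connected :: "(nat \<Rightarrow> nat \<Rightarrow> bool) \<Rightarrow> bool" where
  "graph_connected E \<longleftrightarrow> (\<forall>u v. E\<^sup>*\<^sup>* u v)"

definition vdegree :: "(nat \<Rightarrow> nat \<Rightarrow> bool) \<Rightarrow> nat \<Rightarrow> enat" where
  "vdegree E v = (if finite {w. E v w} then enat (card {w. E v w}) else \<infinity>)"

definition is_ray :: "(nat \<Rightarrow> nat \<Rightarrow> bool) \<Rightarrow> (nat \<Rightarrow> nat) \<Rightarrow> bool" where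
  "is_ray E r \<longleftrightarrow> inj r \<and> (\<forall>n. E (r n) (r (Suc n)))"

definition reach_avoiding :: "(nat \<Rightarrow> nat \<Rightarrow> bool) \<Rightarrow> nat set \<Rightarrow> nat \<Rightarrow> nat \<Rightarrow> bool" where
  "reach_avoiding E S x y \<longleftrightarrow> x \<notin> S \<and> (\<lambda>a b. E a b \<and> a \<notin> S \<and> b \<notin> S)\<^sup>*\<^sup>* x y"

definition rays_equiv :: "(nat \<Rightarrow> nat \<Rightarrow> bool) \<Rightarrow> (nat \<Rightarrow> nat) \<Rightarrow> (nat \<Rightarrow> nat) \<Rightarrow> bool" where
  "rays_equiv E r s \<longleftrightarrow> (\<forall>S. finite S \<longrightarrow>
     (\<exists>n m. (\<forall>k\<ge>n. r k \<notin> S) \<and> (\<forall>k\<ge>m. s k \<notin> S) \<and> reach_avoiding E S (r n) (s m)))"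

definition is_end :: "(nat \<Rightarrow> nat \<Rightarrow> bool) \<Rightarrow> (nat \<Rightarrow> nat) set \<Rightarrow> bool" where
  "is_end E \<omega> \<longleftrightarrow> (\<exists>r. is_ray E r \<and> \<omega> = {s. is_ray E s \<and> rays_equiv E r s})"

definition end_vertex_degree :: "(nat \<Rightarrow> nat \<Rightarrow> bool) \<Rightarrow> (nat \<Rightarrow> nat) set \<Rightarrow> enat" where
  "end_vertex_degree E \<omega> = Sup {enat k | k. \<exists>rs :: nat \<Rightarrow> nat \<Rightarrow> nat.
      (\<forall>i<k. rs i \<in> \<omega>) \<and> (\<forall>i<k. \<forall>j<k. i \<noteq> j \<longrightarrow> range (rs i) \<inter> range (rs j) = {})}"

definition ray_edges :: "(nat \<Rightarrow> nat) \<Rightarrow> nat set set" where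
  "ray_edges r = {{r n, r (Suc n)} | n. True}"

definition end_edge_degree :: "(nat \<Rightarrow> nat \<Rightarrow> bool) \<Rightarrow> (nat \<Rightarrow> nat) set \<Rightarrow> enat" where
  "end_edge_degree E \<omega> = Sup {enat k | k. \<exists>rs :: nat \<Rightarrow> nat \<Rightarrow> nat.
      (\<forall>i<k. rs i \<in> \<omega>) \<and> (\<forall>i<k. \<forall>j<k. i \<noteq> j \<longrightarrow> ray_edges (rs i) \<inter> ray_edges (rs j) = {})}"

text \<open>Points of |G|: vertices, inner points of edges (EPt u v t with u < v, E u v,
0 < t < 1, at parameter t from u towards v) and ends.\<close>
datatype fpoint = Vtx nat | EPt nat nat real | EndPt "(nat \<Rightarrow> nat) set"

definition edge_interval_nbhds :: "(nat \<Rightarrow> nat \<Rightarrow> bool) \<Rightarrow> fpoint set set" where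
  "edge_interval_nbhds E = {{EPt u v t | t. a < t \<and> t < b \<and> 0 < t \<and> t < 1} | u v a b.
      u < v \<and> E u v}"

definition vertex_star_nbhds :: "(nat \<Rightarrow> nat \<Rightarrow> bool) \<Rightarrow> fpoint set set" where
  "vertex_star_nbhds E = {{Vtx v} \<union> {EPt u w t | u w t. u < w \<and> E u w \<and> 0 < t \<and> t < 1 \<and>
        ((u = v \<and> t < \<epsilon>) \<or> (w = v \<and> 1 - \<epsilon> < t))} | v \<epsilon>. 0 < \<epsilon> \<and> \<epsilon> \<le> 1}"

definition end_component :: "(nat \<Rightarrow> nat \<Rightarrow> bool) \<Rightarrow> nat set \<Rightarrow> (nat \<Rightarrow> nat) set \<Rightarrow> nat set" where
  "end_component E S \<omega> = {x. \<exists>r\<in>\<omega>. \<exists>n. (\<forall>k\<ge>n. r k \<notin> S) \<and> reach_avoiding E S (r n) x}"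

definition end_nbhd :: "(nat \<Rightarrow> nat \<Rightarrow> bool) \<Rightarrow> nat set \<Rightarrow> (nat \<Rightarrow> nat) set \<Rightarrow> fpoint set" where
  "end_nbhd E S \<omega> = (let C = end_component E S \<omega> in
      {Vtx x | x. x \<in> C}
    \<union> {EPt u w t | u w t. u < w \<and> E u w \<and> 0 < t \<and> t < 1 \<and> (u \<in> C \<or> w \<in> C)}
    \<union> {EndPt \<omega>' | \<omega>'. is_end E \<omega>' \<and> (\<exists>r\<in>\<omega>'. \<exists>n. \<forall>k\<ge>n. r k \<in> C)})"

definition end_nbhds :: "(nat \<Rightarrow> nat \<Rightarrow> bool) \<Rightarrow> fpoint set set" where
  "end_nbhds E = {end_nbhd E S \<omega> | S \<omega>. finite S \<and> is_end E \<omega>}"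

text \<open>The Freudenthal compactification |G| (for locally finite connected G).\<close>
definition freudenthal :: "(nat \<Rightarrow> nat \<Rightarrow> bool) \<Rightarrow> fpoint topology" where
  "freudenthal E = topology_generated_by
     (edge_interval_nbhds E \<union> vertex_star_nbhds E \<union> end_nbhds E)"

definition hamilton_circle :: "(nat \<Rightarrow> nat \<Rightarrow> bool) \<Rightarrow> fpoint set \<Rightarrow> bool" where
  "hamilton_circle E H \<longleftrightarrow> H \<subseteq> topspace (freudenthal E) \<and>
     (subtopology (freudenthal E) H) homeomorphic_space
       (top_of_set (sphere (0::complex) 1)) \<and>
     (\<forall>v. Vtx v \<in> H)"

end

theory Submission
  imports Defs
begin

text \<open>
  The graph consists of two double rays \<open>P\<close> and \<open>Q\<close> together with a perfect matching that is periodic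
  under shifting \<open>P\<close> by 1 and \<open>Q\<close> by 9. It is a two-ended chain of finite pieces, consecutive pieces
  being joined by three edges. The double rays \<open>P\<close> and \<open>Q\<close> and the two ends form a Hamilton circle.

  A Hamilton circle crosses every finite cut, and a cut of three edges exactly twice, since deleting
  finitely many points from a circle leaves arcs that alternate between the two sides of the cut.
  Contract everything to the left and everything to the right of a piece: a Hamilton circle induces
  a Hamilton cycle of the resulting cubic graph on 12 vertices. All Hamilton cycles of that graph share
  a perfect matching, which contains the edge of \<open>Q\<close> entering the piece from the left and the edge of
  \<open>P\<close> leaving it to the right. Applied to all pieces this fixes the circle on every three-edge cut,
  and then on all edges.
\<close>

section \<open>Separation properties of the circle\<close>

text \<open>In a finite cubic graph every edge lies on an even number of Hamilton cycles (Smith), so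
  such a graph never has exactly one. A contracted piece is finite, cubic and Hamiltonian, hence has
  several; uniqueness can only come from the interaction of neighbouring pieces. At the cut between
  two pieces the left piece forces the edge of \<open>P\<close> and the right piece forces the edge
  of \<open>Q\<close>. As exactly two of the three edges are used, the third one, a chord, is
  excluded; once this is known on both sides of a piece, the degree conditions decide its remaining
  edges.

  A second obstacle is that a Hamilton circle is an arbitrary subspace of \<open>|G|\<close>, not a
  set of edges. It has to be shown that it contains all inner points of an edge or none; then
  midpoints suffice to record which edges it uses. The ends are recovered last, from the fact that
  the circle is closed.\<close>

lemma circle_loop:
  fixes X :: "'a topology"
  assumes hom: "subtopology X H homeomorphic_space top_of_set (sphere (0::complex) 1)"
    and HX: "H \<subseteq> topspace X" and p: "p \<in> H"
  obtains \<phi> :: "real \<Rightarrow> 'a" where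
    "continuous_map euclidean X \<phi>" "\<phi> 0 = p"
    "\<And>t. \<phi> (t + 1) = \<phi> t"
    "\<And>a. \<phi> ` {a..<a+1} = H" "\<And>a. inj_on \<phi> {a..<a+1}"
    "\<And>a b. closedin (subtopology X H) (\<phi> ` {a..b})"
proof -
  let ?S = "sphere (0::complex) 1"
  have "top_of_set ?S homeomorphic_space subtopology X H"
    using hom homeomorphic_space_sym by blast
  then obtain h where h: "homeomorphic_map (top_of_set ?S) (subtopology X H) h"
    unfolding homeomorphic_space by blast
  have him: "h ` ?S = H"
    using homeomorphic_imp_surjective_map[OF h] HX by (simp add: Int_absorb1)
  have hinj: "inj_on h ?S"
    using homeomorphic_imp_injective_map[OF h] by simp
  obtain z0 where z0: "z0 \<in> ?S" "h z0 = p" using p him by auto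
  \<comment> \<open>The factor \<open>z0\<close> rotates the standard parametrization so that time 0
    is mapped to \<open>p\<close>.\<close>
  define \<gamma> where "\<gamma> t = z0 * cis (2 * pi * t)" for t :: real
  have \<gamma>S: "\<gamma> t \<in> ?S" for t using z0 by (simp add: \<gamma>_def norm_mult)
  have z0n: "z0 \<noteq> 0" using z0 by auto
  have \<gamma>c: "continuous_on UNIV \<gamma>"
    unfolding \<gamma>_def by (intro continuous_intros)
  have \<gamma>p: "\<gamma> (t + of_int k) = \<gamma> t" for t k
  proof -
    have "cis (2 * pi * (t + of_int k)) = cis (2*pi*t) * cis (2 * pi * of_int k)"
      by (simp add: cis_mult algebra_simps)
    thus ?thesis by (simp add: \<gamma>_def cis_multiple_2pi)
  qed
  have \<gamma>surj: "\<exists>t\<in>{a..<a+1}. \<gamma> t = z" if z: "z \<in> ?S" for z and a :: real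
  proof -
    have "norm (z / z0) = 1" using z z0 by (simp add: norm_divide)
    then obtain s where s: "z / z0 = cis s" using complex_norm_eq_1_exp_eq
      by (metis cis_Arg norm_zero sgn_div_norm scaleR_one inverse_1 zero_neq_one)
    define t where "t = s / (2*pi)"
    have t: "\<gamma> t = z" using s z0n by (simp add: \<gamma>_def t_def field_simps)
    define t' where "t' = t + of_int (- \<lfloor>t - a\<rfloor>)"
    have "\<gamma> t' = z" unfolding t'_def using \<gamma>p t by blast
    moreover have "t' \<in> {a..<a+1}" unfolding t'_def by simp linarith
    ultimately show ?thesis by blast
  qed
  have \<gamma>inj: "inj_on \<gamma> {a..<a+1}" for a :: real
  proof (rule inj_onI)
    fix x y assume xy: "x \<in> {a..<a+1}" "y \<in> {a..<a+1}" "\<gamma> x = \<gamma> y"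
    hence "cis (2*pi*x) = cis (2*pi*y)" using z0n by (simp add: \<gamma>_def)
    then obtain n :: int where "2*pi*x = 2*pi*y + 2*pi*n"
      by (metis cis.sel(1) cis.sel(2) sin_cos_eq_iff mult.commute mult.left_commute mult.assoc)
    hence "2*pi*x = 2*pi*(y+n)" by (simp add: algebra_simps)
    hence "x = y + n" by simp
    moreover have "\<bar>x - y\<bar> < 1" using xy by auto
    ultimately have "\<bar>real_of_int n\<bar> < 1" by simp
    hence "n = 0" by linarith
    thus "x = y" using \<open>x = y + n\<close> by simp
  qed
  define \<phi> where "\<phi> t = h (\<gamma> t)" for t
  have hc: "continuous_map (top_of_set ?S) (subtopology X H) h"
    using h homeomorphic_imp_continuous_map by blast
  have "continuous_map euclidean (top_of_set ?S) \<gamma>"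
    using \<gamma>c \<gamma>S by (simp add: continuous_map_in_subtopology image_subset_iff)
  hence "continuous_map euclidean (subtopology X H) (h \<circ> \<gamma>)"
    using continuous_map_compose hc by blast
  hence 1: "continuous_map euclidean X \<phi>"
    by (simp add: continuous_map_in_subtopology \<phi>_def[abs_def] o_def)
  have 2: "\<phi> 0 = p" using z0 by (simp add: \<phi>_def \<gamma>_def)
  have 3: "\<phi> (t + 1) = \<phi> t" for t using \<gamma>p[of t 1] by (simp add: \<phi>_def)
  have 4: "\<phi> ` {a..<a+1} = H" for a
  proof -
    have "\<gamma> ` {a..<a+1} = ?S" using \<gamma>S \<gamma>surj[of _ a] by (auto simp: image_iff) force
    thus ?thesis using him by (simp add: \<phi>_def[abs_def] image_image[symmetric])
  qed
  have 5: "inj_on \<phi> {a..<a+1}" for a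
    unfolding \<phi>_def[abs_def] using \<gamma>inj[of a] hinj \<gamma>S
    by (auto simp: inj_on_def)
  \<comment> \<open>The complements of these arcs will serve as neighbourhoods in \<open>H\<close>
    of points off the arc.\<close>
  have 6: "closedin (subtopology X H) (\<phi> ` {a..b})" for a b
  proof -
    have "compact (\<gamma> ` {a..b})"
      using \<gamma>c by (intro compact_continuous_image) (auto intro: continuous_on_subset)
    hence "closedin (top_of_set ?S) (\<gamma> ` {a..b})"
      using \<gamma>S by (metis closed_subset compact_imp_closed image_subsetI)
    hence "closedin (subtopology X H) (h ` \<gamma> ` {a..b})"
      using h homeomorphic_imp_closed_map closed_map_def by blast
    thus ?thesis by (simp add: \<phi>_def[abs_def] image_image)
  qed
  show ?thesis using that[of \<phi>] 1 2 3 4 5 6 by blast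
qed

lemma circle_connected:
  assumes "subtopology X H homeomorphic_space top_of_set (sphere (0::complex) 1)" "H \<subseteq> topspace X"
  shows "connectedin X H"
proof (cases "H = {}")
  case False
  then obtain p where "p \<in> H" by blast
  then obtain \<phi> :: "real \<Rightarrow> 'a" where \<phi>: "continuous_map euclidean X \<phi>" "\<phi> ` {0..<0+1} = H"
    using circle_loop[OF assms, of p] by metis
  have "connectedin X (\<phi> ` {0..<0+1})"
    using \<phi>(1) by (intro connectedin_continuous_map_image[OF \<phi>(1)]) simp
  thus ?thesis using \<phi>(2) by simp
qed simp

text \<open>With \<open>p\<close> as base point, the rest of the circle is the image of an open
  interval. This is why a cut is crossed at least twice: the point of a single crossing could be
  deleted.\<close>

lemma circle_minus_point_connected:
  assumes "subtopology X H homeomorphic_space top_of_set (sphere (0::complex) 1)" "H \<subseteq> topspace X"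
  shows "connectedin X (H - {p})"
proof (cases "p \<in> H")
  case True
  then obtain \<phi> :: "real \<Rightarrow> 'a" where \<phi>: "continuous_map euclidean X \<phi>" "\<phi> 0 = p"
     "\<phi> ` {0..<0+1} = H" "inj_on \<phi> {0..<0+1}"
    using circle_loop[OF assms, of p] by metis
  have "{0..<0+1::real} - {0} = {0<..<1}" by auto
  moreover have "\<phi> ` ({0..<0+1} - {0}) = H - {p}"
    using inj_on_image_set_diff[OF \<phi>(4), of "{0..<0+1}" "{0}"] \<phi> by auto
  ultimately have "\<phi> ` {0<..<1} = H - {p}" by simp
  moreover have "connectedin X (\<phi> ` {0<..<1})"
    by (intro connectedin_continuous_map_image[OF \<phi>(1)]) simp
  ultimately show ?thesis by simp
next
  case False
  thus ?thesis using circle_connected[OF assms] by simp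
qed

lemma connectedin_subset_disjoint_Un:
  assumes "connectedin X S" "openin X U" "openin X W" "U \<inter> W = {}" "S \<subseteq> U \<union> W"
  shows "S \<subseteq> U \<or> S \<subseteq> W"
  using assms unfolding connectedin by blast

text \<open>Three deleted points leave three arcs, each connected and hence contained in
  \<open>U\<close> or in \<open>W\<close>. By \<open>near\<close> the side changes at every deleted
  point, and an odd number of changes around a circle is impossible.\<close>

lemma circle_three_points:
  fixes X :: "'a topology"
  assumes hom: "subtopology X H homeomorphic_space top_of_set (sphere (0::complex) 1)"
    and HX: "H \<subseteq> topspace X"
    and op: "openin X U" "openin X W" and dj: "U \<inter> W = {}"
    and cov: "H \<subseteq> U \<union> W \<union> {p1,p2,p3}"
    and ps: "p1 \<in> H" "p2 \<in> H" "p3 \<in> H" "p1 \<noteq> p2" "p1 \<noteq> p3" "p2 \<noteq> p3"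
    and out: "{p1,p2,p3} \<inter> (U \<union> W) = {}"
    and near: "\<And>p N. p \<in> {p1,p2,p3} \<Longrightarrow> openin X N \<Longrightarrow> p \<in> N \<Longrightarrow> N \<inter> H \<inter> U \<noteq> {} \<and> N \<inter> H \<inter> W \<noteq> {}"
  shows False
proof -
  obtain \<phi> :: "real \<Rightarrow> 'a" where cont: "continuous_map euclidean X \<phi>" and \<phi>0: "\<phi> 0 = p3"
    and per: "\<And>t. \<phi> (t + 1) = \<phi> t"
    and im: "\<And>a. \<phi> ` {a..<a+1} = H" and inj: "\<And>a. inj_on \<phi> {a..<a+1}"
    and cl: "\<And>a b. closedin (subtopology X H) (\<phi> ` {a..b})"
    using circle_loop[OF hom HX ps(3)] by metis
  \<comment> \<open>If the arcs on both sides of time \<open>c\<close> lie in \<open>Z\<close>,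
    removing the closed remainder \<open>?K\<close> leaves a neighbourhood of
    \<open>\<phi> c\<close> in \<open>H\<close> without points of the other side, contrary to
    \<open>near\<close>.\<close>
  have alternate: False
    if abc: "a < c" "c < b" "b \<le> a + 1" and pc: "\<phi> c \<in> {p1,p2,p3}"
      and Z: "Z = U \<or> Z = W" and sub: "\<phi> ` {a<..<c} \<subseteq> Z" "\<phi> ` {c<..<b} \<subseteq> Z" for a b c Z
  proof -
    let ?K = "\<phi> ` {b..a+1}"
    obtain N where N: "openin X N" "H - ?K = N \<inter> H"
      using cl[of b "a+1"] HX unfolding closedin_def openin_subtopology
      by (auto simp: Int_absorb1)
    have "\<phi> c \<notin> ?K"
    proof
      assume "\<phi> c \<in> ?K"
      then obtain s where s: "b \<le> s" "s \<le> a + 1" "\<phi> s = \<phi> c" by auto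
      show False
      proof (cases "s = a + 1")
        case True
        hence "\<phi> a = \<phi> c" using s per by metis
        thus False using inj_onD[OF inj[of a], of a c] abc by auto
      next
        case False
        thus False using inj_onD[OF inj[of a], of s c] abc s by auto
      qed
    qed
    moreover have "\<phi> c \<in> H" using im[of a] abc by auto
    ultimately have "\<phi> c \<in> N" using N(2) by auto
    from near[OF pc N(1) this] obtain y where y: "y \<in> N" "y \<in> H" "y \<in> U \<union> W" "y \<notin> Z"
      using Z dj by blast
    then obtain t where t: "a \<le> t" "t < a + 1" "y = \<phi> t" using im[of a] by (metis atLeastLessThan_iff imageE)
    have "y \<notin> ?K" using y N by blast
    moreover have "\<phi> a \<in> ?K" using per[of a] abc by (auto intro!: image_eqI[of _ _ "a+1"])
    ultimately have "t \<noteq> a" "t < b" using t by (auto simp: not_le[symmetric])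
    moreover have "t \<noteq> c" using y t pc out by auto
    ultimately have "t \<in> {a<..<c} \<or> t \<in> {c<..<b}" using t by auto
    thus False using sub y t by blast
  qed
  have col: "\<phi> ` {a<..<b} \<subseteq> U \<or> \<phi> ` {a<..<b} \<subseteq> W"
    if "\<And>t. a < t \<Longrightarrow> t < b \<Longrightarrow> \<phi> t \<notin> {p1,p2,p3}" for a b
  proof (rule connectedin_subset_disjoint_Un[OF _ op dj])
    show "connectedin X (\<phi> ` {a<..<b})"
      by (intro connectedin_continuous_map_image[OF cont]) simp
    show "\<phi> ` {a<..<b} \<subseteq> U \<union> W"
    proof (rule image_subsetI)
      fix t assume t: "t \<in> {a<..<b}"
      have "\<phi> t \<in> H" using im[of t] by auto
      thus "\<phi> t \<in> U \<union> W" using cov that[of t] t by auto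
    qed
  qed
  obtain t1 where t1: "0 \<le> t1" "t1 < 1" "\<phi> t1 = p1"
    using im[of 0] ps(1) by (metis add_0 atLeastLessThan_iff imageE)
  obtain t2 where t2: "0 \<le> t2" "t2 < 1" "\<phi> t2 = p2"
    using im[of 0] ps(2) by (metis add_0 atLeastLessThan_iff imageE)
  have t0: "t1 \<noteq> 0" "t2 \<noteq> 0" "t1 \<noteq> t2" using t1 t2 \<phi>0 ps by auto
  have only: "\<phi> t \<in> {p1,p2,p3} \<Longrightarrow> 0 \<le> t \<Longrightarrow> t < 1 \<Longrightarrow> t = 0 \<or> t = t1 \<or> t = t2" for t
    using inj_onD[OF inj[of 0], of t t1] inj_onD[OF inj[of 0], of t t2] inj_onD[OF inj[of 0], of t 0] t1 t2 \<phi>0 by auto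
  \<comment> \<open>Here \<open>s1 < s2\<close> are \<open>t1\<close> and \<open>t2\<close> in
    increasing order; the third point sits at time 0 and again at time 1.\<close>
  have main: False if s: "0 < s1" "s1 < s2" "s2 < 1" "\<phi> s1 \<in> {p1,p2,p3}" "\<phi> s2 \<in> {p1,p2,p3}"
    "{s1,s2} = {t1,t2}" for s1 s2
  proof -
    have on: "\<phi> t \<in> {p1,p2,p3} \<Longrightarrow> 0 < t \<Longrightarrow> t < 1 \<Longrightarrow> t = s1 \<or> t = s2" for t
      using only[of t] s(6) by auto
    have c1: "\<phi> ` {0<..<s1} \<subseteq> U \<or> \<phi> ` {0<..<s1} \<subseteq> W" by (rule col) (use on s(1-3) in \<open>force simp del: insert_iff\<close>)
    have c2: "\<phi> ` {s1<..<s2} \<subseteq> U \<or> \<phi> ` {s1<..<s2} \<subseteq> W" by (rule col) (use on s(1-3) in \<open>force simp del: insert_iff\<close>)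
    have c3: "\<phi> ` {s2<..<1} \<subseteq> U \<or> \<phi> ` {s2<..<1} \<subseteq> W" by (rule col) (use on s(1-3) in \<open>force simp del: insert_iff\<close>)
    \<comment> \<open>Shifting the last arc back by one period places it just before time 0, so that
      the base point also has an arc on either side.\<close>
    have sh: "\<phi> ` {s2-1<..<0} \<subseteq> Z" if "\<phi> ` {s2<..<1} \<subseteq> Z" for Z
    proof (rule image_subsetI)
      fix t assume "t \<in> {s2-1<..<0}"
      hence "\<phi> (t+1) \<in> Z" using that by auto
      thus "\<phi> t \<in> Z" using per by simp
    qed
    have p0: "\<phi> 0 \<in> {p1,p2,p3}" using \<phi>0 by simp
    have n1: "\<not> (\<phi> ` {0<..<s1} \<subseteq> Z \<and> \<phi> ` {s1<..<s2} \<subseteq> Z)"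
      and n2: "\<not> (\<phi> ` {s1<..<s2} \<subseteq> Z \<and> \<phi> ` {s2<..<1} \<subseteq> Z)"
      and n3: "\<not> (\<phi> ` {s2<..<1} \<subseteq> Z \<and> \<phi> ` {0<..<s1} \<subseteq> Z)" if "Z = U \<or> Z = W" for Z
    proof -
      have le: "s2 \<le> 0 + 1" "1 \<le> s1 + 1" "s1 \<le> s2 - 1 + 1" "s2 - 1 < 0" using s(1-3) by auto
      show "\<not> (\<phi> ` {0<..<s1} \<subseteq> Z \<and> \<phi> ` {s1<..<s2} \<subseteq> Z)"
        using alternate[OF s(1,2) le(1) s(4) that] by blast
      show "\<not> (\<phi> ` {s1<..<s2} \<subseteq> Z \<and> \<phi> ` {s2<..<1} \<subseteq> Z)"
        using alternate[OF s(2,3) le(2) s(5) that] by blast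
      show "\<not> (\<phi> ` {s2<..<1} \<subseteq> Z \<and> \<phi> ` {0<..<s1} \<subseteq> Z)"
        using alternate[OF le(4) s(1) le(3) p0 that] sh by blast
    qed
    have U: "U = U \<or> U = W" and W: "W = U \<or> W = W" by simp_all
    show False
      using c1 c2 c3 n1[OF U] n1[OF W] n2[OF U] n2[OF W] n3[OF U] n3[OF W] by argo
  qed
  show False
  proof (cases "t1 < t2")
    case True thus ?thesis using main[of t1 t2] t1 t2 t0 by auto
  next
    case False thus ?thesis using main[of t2 t1] t1 t2 t0 by auto
  qed
qed

section \<open>Cuts in the Freudenthal compactification\<close>

lemma reach_avoiding_sym:
  assumes "simple_graph E" "reach_avoiding E S x y"
  shows "reach_avoiding E S y x"
proof -
  let ?R = "\<lambda>a b. E a b \<and> a \<notin> S \<and> b \<notin> S"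
  have "symp ?R" using assms(1) by (auto simp: symp_def simple_graph_def)
  hence "?R\<^sup>*\<^sup>* y x" using assms(2) unfolding reach_avoiding_def
    by (meson sympD symp_rtranclp)
  moreover have "y \<notin> S" using assms(2) unfolding reach_avoiding_def
    by (metis (no_types, lifting) rtranclp.cases)
  ultimately show ?thesis by (simp add: reach_avoiding_def)
qed

lemma reach_avoiding_trans:
  "reach_avoiding E S x y \<Longrightarrow> reach_avoiding E S y z \<Longrightarrow> reach_avoiding E S x z"
  unfolding reach_avoiding_def by auto

lemma reach_avoiding_step:
  "E x y \<Longrightarrow> x \<notin> S \<Longrightarrow> y \<notin> S \<Longrightarrow> reach_avoiding E S x y"
  unfolding reach_avoiding_def by auto

lemma reach_avoiding_ray:
  assumes "is_ray E r" "\<forall>k\<ge>n. r k \<notin> S" "n \<le> m"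
  shows "reach_avoiding E S (r n) (r m)"
  using assms(3)
proof (induction m rule: dec_induct)
  case base thus ?case using assms(2) by (simp add: reach_avoiding_def)
next
  case (step k)
  have "reach_avoiding E S (r k) (r (Suc k))"
    using assms step by (intro reach_avoiding_step) (auto simp: is_ray_def)
  thus ?case using step reach_avoiding_trans by blast
qed

lemma ray_eventually_avoids:
  assumes "is_ray E r" "finite S"
  shows "\<exists>n. \<forall>k\<ge>n. r k \<notin> S"
proof -
  have "finite (r -` S)" using assms by (auto simp: is_ray_def intro: finite_vimageI)
  then obtain n where "\<forall>k\<in>r -` S. k < n" using finite_nat_set_iff_bounded by auto
  thus ?thesis by (metis leD vimageI)
qed

lemma rays_equiv_refl: "is_ray E r \<Longrightarrow> rays_equiv E r r"
  unfolding rays_equiv_def by (metis order_refl ray_eventually_avoids reach_avoiding_ray)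

lemma rays_equiv_sym: "simple_graph E \<Longrightarrow> rays_equiv E r s \<Longrightarrow> rays_equiv E s r"
  unfolding rays_equiv_def by (metis reach_avoiding_sym)

lemma rays_equiv_trans:
  assumes "simple_graph E" "is_ray E s" "rays_equiv E r s" "rays_equiv E s t"
  shows "rays_equiv E r t"
  unfolding rays_equiv_def
proof (intro allI impI)
  fix S :: "nat set" assume S: "finite S"
  obtain n m where 1: "\<forall>k\<ge>n. r k \<notin> S" "\<forall>k\<ge>m. s k \<notin> S" "reach_avoiding E S (r n) (s m)"
    using assms(3) S unfolding rays_equiv_def by blast
  obtain m' l where 2: "\<forall>k\<ge>m'. s k \<notin> S" "\<forall>k\<ge>l. t k \<notin> S" "reach_avoiding E S (s m') (t l)"
    using assms(4) S unfolding rays_equiv_def by blast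
  have "reach_avoiding E S (s m) (s m')"
    using reach_avoiding_ray[OF assms(2)] reach_avoiding_sym[OF assms(1)] 1 2 by (metis nat_le_linear)
  hence "reach_avoiding E S (r n) (t l)" using 1 2 reach_avoiding_trans by metis
  thus "\<exists>n m. (\<forall>k\<ge>n. r k \<notin> S) \<and> (\<forall>k\<ge>m. t k \<notin> S) \<and> reach_avoiding E S (r n) (t m)"
    using 1 2 by blast
qed

lemma end_ray: "is_end E \<omega> \<Longrightarrow> r \<in> \<omega> \<Longrightarrow> is_ray E r"
  unfolding is_end_def by auto

lemma end_nonempty: "is_end E \<omega> \<Longrightarrow> \<exists>r. r \<in> \<omega>"
  unfolding is_end_def using rays_equiv_refl by blast

lemma end_equiv:
  "simple_graph E \<Longrightarrow> is_end E \<omega> \<Longrightarrow> r \<in> \<omega> \<Longrightarrow> s \<in> \<omega> \<Longrightarrow> rays_equiv E r s"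
  unfolding is_end_def using rays_equiv_trans rays_equiv_sym by blast

lemma end_closed:
  "simple_graph E \<Longrightarrow> is_end E \<omega> \<Longrightarrow> r \<in> \<omega> \<Longrightarrow> is_ray E s \<Longrightarrow> rays_equiv E r s \<Longrightarrow> s \<in> \<omega>"
  unfolding is_end_def using rays_equiv_trans by blast

text \<open>Each edge of the cut occurs once, directed out of \<open>C\<close>, so a three-edge cut
  is a set of three pairs.\<close>

definition cut_edges :: "(nat \<Rightarrow> nat \<Rightarrow> bool) \<Rightarrow> nat set \<Rightarrow> (nat \<times> nat) set" where
  "cut_edges E C = {(u, v). u \<in> C \<and> v \<notin> C \<and> E u v}"

text \<open>The side \<open>C\<close> of a cut as a subspace of \<open>|G|\<close>: every cut edge is divided at its midpoint.\<close>

definition region :: "(nat \<Rightarrow> nat \<Rightarrow> bool) \<Rightarrow> nat set \<Rightarrow> fpoint set" where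
  "region E C = {Vtx x | x. x \<in> C}
    \<union> {EPt u v t | u v t. u < v \<and> E u v \<and> 0 < t \<and> t < 1 \<and>
        (u \<in> C \<and> v \<in> C \<or> u \<in> C \<and> t < 1/2 \<or> v \<in> C \<and> 1/2 < t)}
    \<union> {EndPt \<omega> | \<omega>. is_end E \<omega> \<and> (\<exists>r\<in>\<omega>. \<exists>n. \<forall>k\<ge>n. r k \<in> C)}"

text \<open>The parameter 1/2 is invariant under reversal, so \<open>mid\<close> depends only on the
  undirected edge. By \<open>ham_edge_all_or_none\<close> this one point decides whether a Hamilton
  circle contains the edge.\<close>

definition mid :: "nat \<times> nat \<Rightarrow> fpoint" where
  "mid e = EPt (min (fst e) (snd e)) (max (fst e) (snd e)) (1/2)"

definition two_of_three :: "bool \<Rightarrow> bool \<Rightarrow> bool \<Rightarrow> bool" where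
  "two_of_three a b c \<longleftrightarrow> a \<and> b \<and> \<not> c \<or> a \<and> \<not> b \<and> c \<or> \<not> a \<and> b \<and> c"

section \<open>Open sets and the Hausdorff property of the Freudenthal compactification\<close>

locale locally_finite_graph =
  fixes E :: "nat \<Rightarrow> nat \<Rightarrow> bool"
  assumes simple: "simple_graph E" and locfin: "finite {w. E v w}"
begin

abbreviation "X \<equiv> freudenthal E"

lemma sym: "E u v \<Longrightarrow> E v u" and irrefl: "\<not> E v v"
  using simple by (auto simp: simple_graph_def)

lemma open_edge:
  "u < v \<Longrightarrow> E u v \<Longrightarrow> openin X {EPt u v t | t. a < t \<and> t < b \<and> 0 < t \<and> t < 1}"
  unfolding freudenthal_def
  by (rule topology_generated_by_Basis) (auto simp: edge_interval_nbhds_def)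

lemma open_star:
  "0 < \<epsilon> \<Longrightarrow> \<epsilon> \<le> 1 \<Longrightarrow> openin X ({Vtx v} \<union> {EPt u w t | u w t. u < w \<and> E u w \<and> 0 < t \<and> t < 1 \<and>
        ((u = v \<and> t < \<epsilon>) \<or> (w = v \<and> 1 - \<epsilon> < t))})"
  unfolding freudenthal_def
  by (rule topology_generated_by_Basis) (auto simp: vertex_star_nbhds_def)

lemma open_end_nbhd: "finite S \<Longrightarrow> is_end E \<omega> \<Longrightarrow> openin X (end_nbhd E S \<omega>)"
  unfolding freudenthal_def
  by (rule topology_generated_by_Basis) (auto simp: end_nbhds_def)

lemma end_in_nbhd:
  assumes "finite S" "is_end E \<omega>"
  shows "EndPt \<omega> \<in> end_nbhd E S \<omega>"
proof -
  obtain r where r: "r \<in> \<omega>" using end_nonempty assms(2) by blast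
  obtain n where n: "\<forall>k\<ge>n. r k \<notin> S" using ray_eventually_avoids end_ray assms r by metis
  have "\<forall>k\<ge>n. r k \<in> end_component E S \<omega>"
    unfolding end_component_def using r n reach_avoiding_ray[OF end_ray[OF assms(2) r] n] by blast
  thus ?thesis unfolding end_nbhd_def Let_def using r assms(2) by auto
qed

lemma topspace_Vtx [simp]: "Vtx v \<in> topspace X"
  using open_star[of 1 v] openin_subset by fastforce

lemma topspace_EPt [simp]: "EPt u v t \<in> topspace X \<longleftrightarrow> u < v \<and> E u v \<and> 0 < t \<and> t < 1"
proof
  assume "EPt u v t \<in> topspace X"
  thus "u < v \<and> E u v \<and> 0 < t \<and> t < 1"
    unfolding freudenthal_def topology_generated_by_topspace edge_interval_nbhds_def
      vertex_star_nbhds_def end_nbhds_def end_nbhd_def Let_def by auto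
next
  assume "u < v \<and> E u v \<and> 0 < t \<and> t < 1"
  thus "EPt u v t \<in> topspace X" using open_edge[of u v 0 1] openin_subset by fastforce
qed

lemma topspace_EndPt [simp]: "EndPt \<omega> \<in> topspace X \<longleftrightarrow> is_end E \<omega>"
proof
  assume "EndPt \<omega> \<in> topspace X"
  thus "is_end E \<omega>"
    unfolding freudenthal_def topology_generated_by_topspace edge_interval_nbhds_def
      vertex_star_nbhds_def end_nbhds_def end_nbhd_def Let_def by auto
next
  assume "is_end E \<omega>"
  thus "EndPt \<omega> \<in> topspace X"
    using open_end_nbhd[of "{}"] end_in_nbhd[of "{}"] openin_subset by blast
qed

text \<open>These are the end vertices of cut edges, not ends of the graph. Deleting them separates
  the two sides, which turns an edge cut into a vertex separator, the notion in which ends are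
  defined.\<close>

definition cut_ends :: "nat set \<Rightarrow> nat set" where
  "cut_ends C = fst ` cut_edges E C \<union> snd ` cut_edges E C"

lemma finite_cut_ends: "finite (cut_edges E C) \<Longrightarrow> finite (cut_ends C)"
  by (simp add: cut_ends_def)

lemma same_side:
  "E a b \<Longrightarrow> a \<notin> cut_ends C \<or> b \<notin> cut_ends C \<Longrightarrow> a \<in> C \<longleftrightarrow> b \<in> C"
  unfolding cut_ends_def cut_edges_def using sym by force

lemma reach_same_side:
  assumes "reach_avoiding E (cut_ends C) x y"
  shows "x \<in> C \<longleftrightarrow> y \<in> C"
proof -
  have "(\<lambda>a b. E a b \<and> a \<notin> cut_ends C \<and> b \<notin> cut_ends C)\<^sup>*\<^sup>* x y"
    using assms by (simp add: reach_avoiding_def)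
  thus ?thesis by (induction rule: rtranclp_induct) (use same_side in blast)+
qed

text \<open>Only ends need care. A path avoiding \<open>cut_ends C\<close> never changes sides, so
  the component that the end picks out after deleting this set lies in \<open>C\<close>; an edge
  touching that component has an end vertex outside \<open>cut_ends C\<close> and therefore lies in
  \<open>C\<close> entirely.\<close>

lemma open_region:
  assumes fin: "finite (cut_edges E C)"
  shows "openin X (region E C)"
proof (subst openin_subopen, intro ballI)
  fix p assume p: "p \<in> region E C"
  show "\<exists>T. openin X T \<and> p \<in> T \<and> T \<subseteq> region E C"
  proof (cases p)
    case (Vtx x)
    hence x: "x \<in> C" using p by (auto simp: region_def)
    show ?thesis
      by (rule exI, rule conjI[OF open_star[of "1/2" x]]) (use x Vtx in \<open>auto simp: region_def\<close>)
  next
    case (EPt u v t)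
    hence *: "u < v" "E u v" "0 < t" "t < 1" "u \<in> C \<and> v \<in> C \<or> u \<in> C \<and> t < 1/2 \<or> v \<in> C \<and> 1/2 < t"
      using p by (auto simp: region_def)
    let ?T = "\<lambda>a b. {EPt u v t | t. a < t \<and> t < b \<and> 0 < t \<and> t < 1}"
    have op: "openin X (?T a b)" for a b using open_edge * by blast
    from *(5) show ?thesis
    proof (elim disjE)
      assume "u \<in> C \<and> v \<in> C"
      thus ?thesis by (intro exI[of _ "?T 0 1"] conjI op) (use * EPt in \<open>auto simp: region_def\<close>)
    next
      assume "u \<in> C \<and> t < 1/2"
      thus ?thesis by (intro exI[of _ "?T 0 (1/2)"] conjI op) (use * EPt in \<open>auto simp: region_def\<close>)
    next
      assume "v \<in> C \<and> 1/2 < t"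
      thus ?thesis by (intro exI[of _ "?T (1/2) 1"] conjI op) (use * EPt in \<open>auto simp: region_def\<close>)
    qed
  next
    case (EndPt \<omega>)
    then obtain r n where r: "is_end E \<omega>" "r \<in> \<omega>" "\<forall>k\<ge>n. r k \<in> C"
      using p by (auto simp: region_def)
    let ?S = "cut_ends C"
    have S: "finite ?S" using fin by (rule finite_cut_ends)
    have comp: "x \<in> C" "x \<notin> ?S" if x: "x \<in> end_component E ?S \<omega>" for x
    proof -
      obtain s m where s: "s \<in> \<omega>" "\<forall>k\<ge>m. s k \<notin> ?S" "reach_avoiding E ?S (s m) x"
        using x unfolding end_component_def by blast
      obtain i j where ij: "\<forall>k\<ge>i. r k \<notin> ?S" "\<forall>k\<ge>j. s k \<notin> ?S" "reach_avoiding E ?S (r i) (s j)"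
        using end_equiv[OF simple r(1,2) s(1)] S unfolding rays_equiv_def by blast
      have sr: "is_ray E s" "is_ray E r" using end_ray r s by blast+
      \<comment> \<open>The indices given by the component and by the equivalence of the rays may
        differ; they are compared along common tails.\<close>
      have "r i \<in> C \<longleftrightarrow> r (max i n) \<in> C" using reach_same_side reach_avoiding_ray[OF sr(2) ij(1)] by simp
      moreover have "s j \<in> C \<longleftrightarrow> s (max j m) \<in> C" using reach_same_side reach_avoiding_ray[OF sr(1) ij(2)] by simp
      moreover have "s m \<in> C \<longleftrightarrow> s (max j m) \<in> C" using reach_same_side reach_avoiding_ray[OF sr(1) s(2)] by simp
      ultimately show "x \<in> C" using reach_same_side[OF ij(3)] reach_same_side[OF s(3)] r(3) by simp
      show "x \<notin> ?S" using reach_avoiding_sym[OF simple s(3)] by (simp add: reach_avoiding_def)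
    qed
    have "end_nbhd E ?S \<omega> \<subseteq> region E C"
    proof
      fix q assume q: "q \<in> end_nbhd E ?S \<omega>"
      show "q \<in> region E C"
      proof (cases q)
        case (Vtx x)
        thus ?thesis using q comp by (auto simp: end_nbhd_def Let_def region_def)
      next
        case (EPt u v t)
        hence *: "u < v" "E u v" "0 < t" "t < 1" "u \<in> end_component E ?S \<omega> \<or> v \<in> end_component E ?S \<omega>"
          using q by (auto simp: end_nbhd_def Let_def)
        hence "u \<in> C \<and> v \<in> C" using comp[of u] comp[of v] same_side[OF *(2), of C] by blast
        thus ?thesis using * EPt by (auto simp: region_def)
      next
        case (EndPt \<omega>')
        thus ?thesis using q comp by (auto simp: end_nbhd_def Let_def region_def) blast
      qed
    qed
    thus ?thesis using open_end_nbhd[OF S r(1)] end_in_nbhd[OF S r(1)] EndPt by blast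
  qed
qed

lemma finite_cut_edges_finite: "finite C \<Longrightarrow> finite (cut_edges E C)"
proof -
  assume "finite C"
  hence "finite (SIGMA u:C. {w. E u w})" using locfin by blast
  moreover have "cut_edges E C \<subseteq> (SIGMA u:C. {w. E u w})" by (auto simp: cut_edges_def)
  ultimately show ?thesis using finite_subset by blast
qed

lemma cut_edges_Compl: "cut_edges E (- C) = prod.swap ` cut_edges E C"
  unfolding cut_edges_def using sym by (auto simp: image_iff)

lemma finite_cut_edges_Compl: "finite (cut_edges E (- C)) \<longleftrightarrow> finite (cut_edges E C)"
  using cut_edges_Compl[of C] cut_edges_Compl[of "- C"] by (metis double_complement finite_imageI)

text \<open>Only an end could lie on both sides. Its rays in \<open>C\<close> and in
  \<open>- C\<close> would be joined outside \<open>cut_ends C\<close>, where no path changes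
  sides.\<close>

lemma region_disjoint:
  assumes fin: "finite (cut_edges E C)"
  shows "region E C \<inter> region E (- C) = {}"
proof -
  have False if h: "is_end E \<omega>" "r \<in> \<omega>" "\<forall>k\<ge>n. r k \<in> C" "s \<in> \<omega>" "\<forall>k\<ge>m. s k \<notin> C" for \<omega> r s n m
  proof -
    let ?S = "cut_ends C"
    obtain i j where ij: "\<forall>k\<ge>i. r k \<notin> ?S" "\<forall>k\<ge>j. s k \<notin> ?S" "reach_avoiding E ?S (r i) (s j)"
      using end_equiv[OF simple h(1,2,4)] finite_cut_ends[OF fin] unfolding rays_equiv_def by blast
    have sr: "is_ray E s" "is_ray E r" using end_ray that by blast+
    have "r i \<in> C \<longleftrightarrow> r (max i n) \<in> C" using reach_same_side reach_avoiding_ray[OF sr(2) ij(1)] by simp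
    moreover have "s j \<in> C \<longleftrightarrow> s (max j m) \<in> C" using reach_same_side reach_avoiding_ray[OF sr(1) ij(2)] by simp
    ultimately show False using reach_same_side[OF ij(3)] that by simp
  qed
  hence "EndPt \<omega> \<notin> region E C \<inter> region E (- C)" for \<omega>
    unfolding region_def by blast
  moreover have "Vtx v \<notin> region E C \<inter> region E (- C)" "EPt u v t \<notin> region E C \<inter> region E (- C)" for u v t
    unfolding region_def by auto
  ultimately show ?thesis by (metis disjoint_iff IntI fpoint.exhaust)
qed

lemma mid_simps: "u < v \<Longrightarrow> mid (u, v) = EPt u v (1/2)" "u < v \<Longrightarrow> mid (v, u) = EPt u v (1/2)"
  by (auto simp: mid_def)

lemma region_cover:
  assumes fin: "finite (cut_edges E C)"
  shows "topspace X \<subseteq> region E C \<union> region E (- C) \<union> mid ` cut_edges E C"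
proof
  fix p assume p: "p \<in> topspace X"
  show "p \<in> region E C \<union> region E (- C) \<union> mid ` cut_edges E C"
  proof (cases p)
    case (Vtx x) thus ?thesis by (auto simp: region_def)
  next
    case (EPt u v t)
    hence *: "u < v" "E u v" "0 < t" "t < 1" using p by auto
    show ?thesis
    proof (cases "(u \<in> C \<longleftrightarrow> v \<in> C) \<or> t \<noteq> 1/2")
      case True thus ?thesis using * EPt by (auto simp: region_def)
    next
      case False
      hence "(u, v) \<in> cut_edges E C \<or> (v, u) \<in> cut_edges E C"
        using * sym by (auto simp: cut_edges_def)
      moreover have "p = mid (u, v)" "p = mid (v, u)" using False EPt mid_simps[OF *(1)] by auto
      ultimately show ?thesis by blast
    qed
  next
    case (EndPt \<omega>)
    hence e: "is_end E \<omega>" using p by simp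
    then obtain r where r: "r \<in> \<omega>" "is_ray E r" using end_nonempty end_ray by blast
    obtain n where n: "\<forall>k\<ge>n. r k \<notin> cut_ends C" using ray_eventually_avoids[OF r(2) finite_cut_ends[OF fin]] by blast
    have "\<forall>k\<ge>n. r n \<in> C \<longleftrightarrow> r k \<in> C"
      using reach_avoiding_ray[OF r(2) n] reach_same_side by blast
    hence "(\<forall>k\<ge>n. r k \<in> C) \<or> (\<forall>k\<ge>n. r k \<in> - C)" by auto
    thus ?thesis using e r EndPt by (auto simp: region_def)
  qed
qed

lemma end_in_region_Compl:
  assumes "finite C" "is_end E \<omega>"
  shows "EndPt \<omega> \<in> region E (- C)"
proof -
  obtain r where r: "r \<in> \<omega>" "is_ray E r" using end_nonempty end_ray assms by blast
  thus ?thesis using ray_eventually_avoids[OF r(2) assms(1)] assms(2) by (auto simp: region_def)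
qed

text \<open>Points on different sides of a finite cut are separated by \<open>region\<close>. This
  covers two vertices, two ends, and an end with any other point; the pairs left over involve an
  edge point and are separated by intervals and small stars.\<close>

lemma Hausdorff_freudenthal: "Hausdorff_space X"
proof -
  define sep where "sep x y \<longleftrightarrow> (\<exists>U V. openin X U \<and> openin X V \<and> x \<in> U \<and> y \<in> V \<and> disjnt U V)" for x y
  have sym_sep: "sep x y \<Longrightarrow> sep y x" for x y unfolding sep_def disjnt_def by blast
  have reg: "sep x y" if "finite (cut_edges E C)" "x \<in> region E C" "y \<in> region E (- C)" for x y C
    unfolding sep_def disjnt_def
  proof (intro exI conjI)
    show "openin X (region E C)" "openin X (region E (- C))"
      using open_region that(1) finite_cut_edges_Compl by blast+
  qed (use that region_disjoint in auto)
  have VV: "sep (Vtx v) (Vtx w)" if "v \<noteq> w" for v w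
    using that by (intro reg[of "{v}"] finite_cut_edges_finite) (auto simp: region_def)
  have VD: "sep (Vtx v) (EndPt \<omega>)" if "is_end E \<omega>" for v \<omega>
    using that by (intro reg[of "{v}"] finite_cut_edges_finite end_in_region_Compl) (auto simp: region_def)
  have ED: "sep (EPt u v t) (EndPt \<omega>)" if "is_end E \<omega>" "u < v" "E u v" "0 < t" "t < 1" for u v t \<omega>
    using that by (intro reg[of "{u,v}"] finite_cut_edges_finite end_in_region_Compl) (auto simp: region_def)
  have VE: "sep (Vtx x) (EPt u v t)" if "u < v" "E u v" "0 < t" "t < 1" for u v t x
  proof -
    define \<epsilon> where "\<epsilon> = min t (1 - t) / 2"
    have \<epsilon>: "0 < \<epsilon>" "\<epsilon> \<le> 1" "\<epsilon> < t" "t < 1 - \<epsilon>" using that by (auto simp: \<epsilon>_def min_def field_simps)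
    show ?thesis unfolding sep_def disjnt_def
      by (intro exI conjI, rule open_star[OF \<epsilon>(1,2)], rule open_edge[OF that(1,2), of \<epsilon> "1-\<epsilon>"])
         (use that \<epsilon> in auto)
  qed
  have EE1: "sep (EPt u v t) (EPt u v t')" if "u < v" "E u v" "0 < t" "t < t'" "t' < 1" for u v t t'
    unfolding sep_def disjnt_def
    by (intro exI conjI, rule open_edge[OF that(1,2), of 0 "(t+t')/2"], rule open_edge[OF that(1,2), of "(t+t')/2" 1])
       (use that in auto)
  have EE2: "sep (EPt u v t) (EPt u' v' t')"
    if "u < v" "E u v" "0 < t" "t < 1" "u' < v'" "E u' v'" "0 < t'" "t' < 1" "(u,v) \<noteq> (u',v')" for u v t u' v' t'
    unfolding sep_def disjnt_def
    by (intro exI conjI, rule open_edge[OF that(1,2), of 0 1], rule open_edge[OF that(5,6), of 0 1])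
       (use that in auto)
  have DD: "sep (EndPt \<omega>) (EndPt \<omega>')" if h: "is_end E \<omega>" "is_end E \<omega>'" "\<omega> \<noteq> \<omega>'" for \<omega> \<omega>'
  proof -
    obtain r s where r: "r \<in> \<omega>" "is_ray E r" and s: "s \<in> \<omega>'" "is_ray E s"
      using end_nonempty end_ray h by metis
    have "\<not> rays_equiv E r s"
    proof
      assume "rays_equiv E r s"
      hence "t \<in> \<omega> \<longleftrightarrow> t \<in> \<omega>'" for t
        using end_closed[OF simple h(1) r(1)] end_closed[OF simple h(2) s(1)]
          end_equiv[OF simple h(1) r(1)] end_equiv[OF simple h(2) s(1)] end_ray[OF h(1)] end_ray[OF h(2)]
          rays_equiv_trans[OF simple s(2)] rays_equiv_trans[OF simple r(2)] rays_equiv_sym[OF simple] by blast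
      thus False using h(3) by blast
    qed
    then obtain S where S: "finite S" and no: "\<not> (\<exists>n m. (\<forall>k\<ge>n. r k \<notin> S) \<and> (\<forall>k\<ge>m. s k \<notin> S) \<and> reach_avoiding E S (r n) (s m))"
      unfolding rays_equiv_def by blast
    obtain n m where nm: "\<forall>k\<ge>n. r k \<notin> S" "\<forall>k\<ge>m. s k \<notin> S"
      using ray_eventually_avoids S r s by metis
    \<comment> \<open>\<open>C\<close> is the component of the graph minus \<open>S\<close> that
      contains a tail of \<open>r\<close>. It is infinite, but every edge leaving it ends in
      \<open>S\<close>, so local finiteness makes the cut finite.\<close>
    define C where "C = {x. reach_avoiding E S (r n) x}"
    have "cut_edges E C \<subseteq> prod.swap ` (SIGMA u:S. {w. E u w})"
    proof
      fix e assume "e \<in> cut_edges E C"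
      then obtain a b where ab: "e = (a, b)" "a \<in> C" "b \<notin> C" "E a b" by (auto simp: cut_edges_def)
      have "reach_avoiding E S a (r n)" using ab(2) reach_avoiding_sym[OF simple] by (simp add: C_def)
      hence "a \<notin> S" by (simp add: reach_avoiding_def)
      have "b \<in> S"
      proof (rule ccontr)
        assume "b \<notin> S"
        hence "reach_avoiding E S a b" using reach_avoiding_step \<open>a \<notin> S\<close> ab(4) by simp
        thus False using ab(2,3) reach_avoiding_trans unfolding C_def by (metis mem_Collect_eq)
      qed
      thus "e \<in> prod.swap ` (SIGMA u:S. {w. E u w})" using ab sym by (auto simp: image_iff)
    qed
    hence fin: "finite (cut_edges E C)" using S locfin by (meson finite_SigmaI finite_imageI finite_subset)
    have "EndPt \<omega> \<in> region E C"
      using h r reach_avoiding_ray[OF r(2) nm(1)] by (auto simp: region_def C_def)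
    moreover have "s k \<notin> C" if "k \<ge> m" for k
    proof
      assume "s k \<in> C"
      moreover have "reach_avoiding E S (s k) (s m)"
        using reach_avoiding_sym[OF simple reach_avoiding_ray[OF s(2) nm(2) that]] .
      ultimately have "reach_avoiding E S (r n) (s m)" unfolding C_def using reach_avoiding_trans by blast
      thus False using no nm by blast
    qed
    hence "EndPt \<omega>' \<in> region E (- C)" using h s by (auto simp: region_def)
    ultimately show ?thesis using reg fin by blast
  qed
  have "sep x y" if xy: "x \<in> topspace X" "y \<in> topspace X" "x \<noteq> y" for x y
  proof (cases x)
    case x: (Vtx a)
    show ?thesis by (cases y) (use xy x VV VE VD in auto)
  next
    case x: (EPt u v t)
    show ?thesis
    proof (cases y)
      case (Vtx v)
      thus ?thesis using xy x VE sym_sep by auto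
    next
      case y: (EPt u' v' t')
      have *: "u < v" "E u v" "0 < t" "t < 1" "u' < v'" "E u' v'" "0 < t'" "t' < 1"
        using x y xy by auto
      consider "(u,v) \<noteq> (u',v')" | "u = u'" "v = v'" "t < t'" | "u = u'" "v = v'" "t' < t"
        using x y xy(3) by fastforce
      thus ?thesis
      proof cases
        case 1 thus ?thesis using EE2 * x y by blast
      next
        case 2 thus ?thesis using EE1[of u v t t'] * x y by blast
      next
        case 3 thus ?thesis using EE1[of u v t' t] sym_sep * x y by blast
      qed
    next
      case (EndPt \<omega>)
      thus ?thesis using xy x ED by auto
    qed
  next
    case x: (EndPt a)
    show ?thesis by (cases y) (use xy x VD ED DD sym_sep in auto)
  qed
  thus ?thesis unfolding Hausdorff_space_def sep_def by blast
qed

section \<open>Edges and finite cuts traversed by a Hamilton circle\<close>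

lemma continuous_EPt:
  assumes "u < v" "E u v"
  shows "continuous_map (top_of_set {0<..<1}) X (EPt u v)"
  unfolding freudenthal_def
proof (rule continuous_on_generated_topo)
  fix B assume "B \<in> edge_interval_nbhds E \<union> vertex_star_nbhds E \<union> end_nbhds E"
  then consider "B \<in> edge_interval_nbhds E" | "B \<in> vertex_star_nbhds E" | "B \<in> end_nbhds E" by blast
  hence "\<exists>T. open T \<and> EPt u v -` B \<inter> {0<..<1} = {0<..<1} \<inter> T"
  proof cases
    case 1
    then obtain u' v' a b where B: "B = {EPt u' v' t | t. a < t \<and> t < b \<and> 0 < t \<and> t < 1}"
      by (auto simp: edge_interval_nbhds_def)
    show ?thesis
      by (rule exI[of _ "if u = u' \<and> v = v' then {a<..<b} else {}"]) (auto simp: B)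
  next
    case 2
    then obtain x \<epsilon> where B: "B = {Vtx x} \<union> {EPt u w t | u w t. u < w \<and> E u w \<and> 0 < t \<and> t < 1 \<and>
        ((u = x \<and> t < \<epsilon>) \<or> (w = x \<and> 1 - \<epsilon> < t))}"
      by (auto simp: vertex_star_nbhds_def)
    show ?thesis
      by (rule exI[of _ "(if u = x then {..<\<epsilon>} else {}) \<union> (if v = x then {1-\<epsilon><..} else {})"])
         (use assms in \<open>auto simp: B\<close>)
  next
    case 3
    then obtain S \<omega> where B: "B = end_nbhd E S \<omega>" by (auto simp: end_nbhds_def)
    show ?thesis
      by (rule exI[of _ "if u \<in> end_component E S \<omega> \<or> v \<in> end_component E S \<omega> then UNIV else {}"])
         (use assms in \<open>auto simp: B end_nbhd_def Let_def\<close>)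
  qed
  thus "openin (top_of_set {0<..<1}) (EPt u v -` B \<inter> topspace (top_of_set {0<..<1}))"
    by (simp add: openin_open)
next
  have "EPt u v ` {0<..<1} \<subseteq> topspace X" using assms by auto
  thus "EPt u v ` topspace (top_of_set {0<..<1}) \<subseteq> \<Union> (edge_interval_nbhds E \<union> vertex_star_nbhds E \<union> end_nbhds E)"
    by (simp add: freudenthal_def topology_generated_by_topspace)
qed

text \<open>A point of the circle inside a segment of the edge would be cut off from the vertices by
  the two end points of the segment. If one of these is not in \<open>H\<close>, at most one point
  of the circle is deleted, and the rest must stay connected.\<close>

lemma ham_edge_all_or_none:
  assumes ham: "hamilton_circle E H" and uv: "u < v" "E u v"
    and q: "0 < q" "q < 1" "EPt u v q \<notin> H" and s: "0 < s" "s < 1"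
  shows "EPt u v s \<notin> H"
proof -
  have HX: "H \<subseteq> topspace X" and hom: "subtopology X H homeomorphic_space top_of_set (sphere (0::complex) 1)"
    and V: "\<And>v. Vtx v \<in> H"
    using ham by (auto simp: hamilton_circle_def)
  have no: "EPt u v x \<notin> H"
    if ab: "0 < a" "a < x" "x < b" "b < 1" "EPt u v a \<notin> H \<or> EPt u v b \<notin> H" for a b x
  proof
    assume x: "EPt u v x \<in> H"
    let ?U = "{EPt u v t | t. a < t \<and> t < b \<and> 0 < t \<and> t < 1}"
    let ?W = "topspace X - EPt u v ` {a..b}"
    let ?K = "H - {EPt u v a} - {EPt u v b}"
    have "compactin X (EPt u v ` {a..b})"
      using ab by (intro image_compactin[OF _ continuous_EPt[OF uv]]) (auto simp: compactin_subtopology)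
    hence W: "openin X ?W"
      using compactin_imp_closedin[OF Hausdorff_freudenthal] by blast
    have "connectedin X ?K"
    proof (cases "EPt u v a \<in> H")
      case True
      hence "?K = H - {EPt u v a}" using ab(5) by auto
      thus ?thesis using circle_minus_point_connected[OF hom HX] by simp
    next
      case False
      hence "?K = H - {EPt u v b}" by auto
      thus ?thesis using circle_minus_point_connected[OF hom HX] by simp
    qed
    hence "?K \<subseteq> ?U \<or> ?K \<subseteq> ?W"
    proof (rule connectedin_subset_disjoint_Un[OF _ open_edge[OF uv] W])
      show "?U \<inter> ?W = {}" by auto
      show "?K \<subseteq> ?U \<union> ?W"
      proof
        fix p assume p: "p \<in> ?K"
        show "p \<in> ?U \<union> ?W"
        proof (cases "p \<in> EPt u v ` {a..b}")
          case True
          then obtain t where "p = EPt u v t" "a \<le> t" "t \<le> b" by auto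
          thus ?thesis using p ab by (auto simp: order_le_less)
        qed (use p HX in auto)
      qed
    qed
    moreover have "Vtx u \<in> ?K" "Vtx u \<notin> ?U" using V by auto
    moreover have "EPt u v x \<in> ?K" "EPt u v x \<notin> ?W" using x ab by auto
    ultimately show False by blast
  qed
  show ?thesis
  proof (cases "s = q")
    case False
    \<comment> \<open>One end of the segment is \<open>q\<close>; the other is an arbitrary inner
      point of the edge beyond \<open>s\<close>.\<close>
    thus ?thesis using no[of "s/2" s q] no[of q s "(s+1)/2"] q s by (cases "s < q") auto
  qed (use q in simp)
qed

text \<open>Excluding \<open>e0\<close> yields a second crossing: if no other cut edge were used,
  the circle minus \<open>mid e0\<close> would be connected, yet it has vertices in both regions and
  is covered by them.\<close>

lemma ham_cut_crossed:
  assumes ham: "hamilton_circle E H" and fin: "finite (cut_edges E C)" and C: "C \<noteq> {}" "C \<noteq> UNIV"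
  shows "\<exists>e\<in>cut_edges E C. e \<noteq> e0 \<and> mid e \<in> H"
proof (rule ccontr)
  assume no: "\<not> ?thesis"
  have HX: "H \<subseteq> topspace X" and hom: "subtopology X H homeomorphic_space top_of_set (sphere (0::complex) 1)"
    and V: "\<And>v. Vtx v \<in> H"
    using ham by (auto simp: hamilton_circle_def)
  let ?K = "H - {mid e0}"
  have "?K \<subseteq> region E C \<or> ?K \<subseteq> region E (- C)"
  proof (rule connectedin_subset_disjoint_Un)
    show "connectedin X ?K" by (rule circle_minus_point_connected[OF hom HX])
    show "openin X (region E C)" "openin X (region E (- C))"
      using open_region fin finite_cut_edges_Compl by blast+
    show "region E C \<inter> region E (- C) = {}" using region_disjoint fin .
    have "?K \<inter> mid ` cut_edges E C = {}" using no by auto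
    thus "?K \<subseteq> region E C \<union> region E (- C)"
      using order_trans[OF HX region_cover[OF fin]] by auto
  qed
  moreover obtain x y where "x \<in> C" "y \<notin> C" using C by blast
  moreover have "Vtx x \<in> ?K" for x using V by (simp add: mid_def)
  ultimately show False by (auto simp: region_def)
qed

lemma mid_inj_on: "inj_on mid (cut_edges E C)"
  by (auto simp: inj_on_def mid_def cut_edges_def min_def max_def split: if_splits)

text \<open>A used edge is contained in \<open>H\<close> with all its inner points, so
  \<open>H\<close> has points on both sides arbitrarily close to each midpoint. This is the
  hypothesis \<open>near\<close> of \<open>circle_three_points\<close>.\<close>

lemma ham_three_cut:
  assumes ham: "hamilton_circle E H" and cut: "cut_edges E C = {e1, e2, e3}"
    and dist: "e1 \<noteq> e2" "e1 \<noteq> e3" "e2 \<noteq> e3"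
  shows "\<not> (mid e1 \<in> H \<and> mid e2 \<in> H \<and> mid e3 \<in> H)"
proof
  assume mH: "mid e1 \<in> H \<and> mid e2 \<in> H \<and> mid e3 \<in> H"
  have HX: "H \<subseteq> topspace X" and hom: "subtopology X H homeomorphic_space top_of_set (sphere (0::complex) 1)"
    using ham by (auto simp: hamilton_circle_def)
  have fin: "finite (cut_edges E C)" using cut by simp
  have near: "N \<inter> H \<inter> region E C \<noteq> {} \<and> N \<inter> H \<inter> region E (- C) \<noteq> {}"
    if p: "p \<in> {mid e1, mid e2, mid e3}" "openin X N" "p \<in> N" for p N
  proof -
    obtain e where e: "p = mid e" "e \<in> cut_edges E C" using p(1) cut by blast
    obtain u v where uv: "u < v" "E u v" "p = EPt u v (1/2)" "u \<in> C \<longleftrightarrow> v \<notin> C"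
    proof (cases "fst e < snd e")
      case True
      thus ?thesis using e that[of "fst e" "snd e"] by (auto simp: cut_edges_def mid_simps)
    next
      case False
      hence "snd e < fst e" using e irrefl by (auto simp: cut_edges_def not_less order_le_less)
      thus ?thesis using e that[of "snd e" "fst e"] sym by (auto simp: cut_edges_def mid_simps)
    qed
    have "EPt u v (1/2) \<in> H" using uv(3) p(1) mH by auto
    hence all: "EPt u v t \<in> H" if "0 < t" "t < 1" for t
      using ham_edge_all_or_none[OF ham uv(1,2), of t "1/2"] that by argo
    have "openin (top_of_set {0<..<1}) {t \<in> topspace (top_of_set {0<..<1}). EPt u v t \<in> N}"
      using continuous_EPt[OF uv(1,2)] p(2) by (rule openin_continuous_map_preimage)
    hence "open {t \<in> {0<..<1}. EPt u v t \<in> N}" using openin_open_eq[of "{0<..<1::real}"] by simp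
    moreover have "1/2 \<in> {t \<in> {0<..<1}. EPt u v t \<in> N}" using p uv by simp
    ultimately obtain d where d: "d > 0" "ball (1/2) d \<subseteq> {t \<in> {0<..<1}. EPt u v t \<in> N}"
      using open_contains_ball by blast
    have "1/2 - d/2 \<in> ball (1/2) d" "1/2 + d/2 \<in> ball (1/2) d" using d(1) by (auto simp: dist_real_def)
    hence "1/2 - d/2 \<in> {t \<in> {0<..<1}. EPt u v t \<in> N}" "1/2 + d/2 \<in> {t \<in> {0<..<1}. EPt u v t \<in> N}"
      using d(2) by blast+
    hence m: "0 < 1/2 - d/2" "EPt u v (1/2 - d/2) \<in> N" "1/2 + d/2 < 1" "EPt u v (1/2 + d/2) \<in> N"
      unfolding mem_Collect_eq greaterThanLessThan_iff by blast+
    have "EPt u v (1/2 - d/2) \<in> H" "EPt u v (1/2 + d/2) \<in> H" using all m d(1) by auto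
    \<comment> \<open>\<open>u\<close> is the end vertex with the smaller number, which may lie on
      either side of the cut.\<close>
    moreover have "EPt u v (1/2 - d/2) \<in> region E (if u \<in> C then C else - C)"
         "EPt u v (1/2 + d/2) \<in> region E (if u \<in> C then - C else C)"
      using uv m d(1) by (auto simp: region_def)
    ultimately show ?thesis using m by (auto split: if_splits)
  qed
  show False
  proof (rule circle_three_points[OF hom HX _ _ region_disjoint[OF fin], of "mid e1" "mid e2" "mid e3"])
    show "openin X (region E C)" "openin X (region E (- C))"
      using open_region fin finite_cut_edges_Compl by blast+
    show "H \<subseteq> region E C \<union> region E (- C) \<union> {mid e1, mid e2, mid e3}"
      using region_cover[OF fin] HX cut by auto
    show "mid e1 \<in> H" "mid e2 \<in> H" "mid e3 \<in> H" using mH by auto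
    show "mid e1 \<noteq> mid e2" "mid e1 \<noteq> mid e3" "mid e2 \<noteq> mid e3"
      using mid_inj_on[of C] dist cut by (auto simp: inj_on_def)
    have "mid e \<notin> region E C \<union> region E (- C)" if "e \<in> cut_edges E C" for e
      using that by (auto simp: region_def mid_def cut_edges_def min_def max_def split: if_splits)
    thus "{mid e1, mid e2, mid e3} \<inter> (region E C \<union> region E (- C)) = {}" using cut by auto
    show "\<And>p N. p \<in> {mid e1, mid e2, mid e3} \<Longrightarrow> openin X N \<Longrightarrow> p \<in> N \<Longrightarrow>
      N \<inter> H \<inter> region E C \<noteq> {} \<and> N \<inter> H \<inter> region E (- C) \<noteq> {}" using near by blast
  qed
qed

text \<open>Taking each of the three edges as the excluded one gives at least two crossings. The
  star of a cubic vertex is such a cut, so the degree conditions at vertices are instances.\<close>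

lemma ham_three_cut_two:
  assumes ham: "hamilton_circle E H" and cut: "cut_edges E C = {e1, e2, e3}"
    and dist: "e1 \<noteq> e2" "e1 \<noteq> e3" "e2 \<noteq> e3"
  shows "two_of_three (mid e1 \<in> H) (mid e2 \<in> H) (mid e3 \<in> H)"
proof -
  have "C \<noteq> {}" "C \<noteq> UNIV" using cut by (auto simp: cut_edges_def)
  moreover have "finite (cut_edges E C)" using cut by simp
  ultimately have "\<exists>e\<in>{e1, e2, e3}. e \<noteq> e0 \<and> mid e \<in> H" for e0
    using ham_cut_crossed[OF ham] cut by metis
  from this[of e1] this[of e2] this[of e3] show ?thesis
    using ham_three_cut[OF ham cut dist] dist unfolding two_of_three_def by auto
qed

end

section \<open>The graph and its ends\<close>

text \<open>The vertex set has to be all of \<open>nat\<close>, so the double rays take the even and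
  the odd numbers.\<close>

definition pv :: "int \<Rightarrow> nat" where "pv i = 2 * int_encode i"
definition qv :: "int \<Rightarrow> nat" where "qv i = 2 * int_encode i + 1"

text \<open>The chords of the double ray \<open>qv\<close> repeat with period 9; the vertices congruent to 4 have no chord
  and are matched to \<open>pv\<close> instead.\<close>

definition chord :: "int \<Rightarrow> int" where
  "chord i = (if i mod 9 = 0 then 7 else if i mod 9 = 1 then 13 else if i mod 9 = 2 then 4
    else if i mod 9 = 3 then 5 else if i mod 9 = 5 then -13 else if i mod 9 = 6 then -4
    else if i mod 9 = 7 then -7 else -5)"

definition mate :: "int \<Rightarrow> nat" where
  "mate i = (if i mod 9 = 4 then pv (i div 9) else qv (i + chord i))"

definition adj :: "nat \<Rightarrow> nat \<Rightarrow> bool" where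
  "adj u v \<longleftrightarrow> (\<exists>i. u = pv i \<and> v \<in> {pv (i - 1), pv (i + 1), qv (9 * i + 4)})
    \<or> (\<exists>i. u = qv i \<and> v \<in> {qv (i - 1), qv (i + 1), mate i})"

lemma pv_eq [simp]: "pv i = pv j \<longleftrightarrow> i = j" and qv_eq [simp]: "qv i = qv j \<longleftrightarrow> i = j"
  by (auto simp: pv_def qv_def inj_eq[OF inj_int_encode])

lemma pv_neq_qv [simp]: "pv i \<noteq> qv j" "qv j \<noteq> pv i"
  by (auto simp: pv_def qv_def dest: arg_cong[of _ _ even])

lemma vertex_cases: obtains (P) i where "v = pv i" | (Q) i where "v = qv i"
proof (cases "even v")
  case True
  hence "v = pv (int_decode (v div 2))" by (simp add: pv_def)
  thus ?thesis using P by blast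
next
  case False
  hence "v = qv (int_decode (v div 2))" by (simp add: qv_def)
  thus ?thesis using Q by blast
qed

lemma adj_pv: "adj (pv i) v \<longleftrightarrow> v \<in> {pv (i - 1), pv (i + 1), qv (9 * i + 4)}"
  and adj_qv: "adj (qv i) v \<longleftrightarrow> v \<in> {qv (i - 1), qv (i + 1), mate i}"
  by (auto simp: adj_def)

lemma mod9_cases:
  obtains k :: int where "i = 9*k" | k where "i = 9*k+1" | k where "i = 9*k+2" | k where "i = 9*k+3"
  | k where "i = 9*k+4" | k where "i = 9*k+5" | k where "i = 9*k+6" | k where "i = 9*k+7" | k where "i = 9*k+8"
proof -
  have "i = 9 * (i div 9) + i mod 9" by simp
  moreover have "i mod 9 \<in> {0,1,2,3,4,5,6,7,8}"
    using pos_mod_bound[of 9 i] pos_mod_sign[of 9 i] by auto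
  ultimately show ?thesis using that by (metis add.right_neutral empty_iff insert_iff)
qed

lemma mate_simps [simp]:
  "mate (9*k) = qv (9*k+7)" "mate (9*k+1) = qv (9*k+14)" "mate (9*k+2) = qv (9*k+6)"
  "mate (9*k+3) = qv (9*k+8)" "mate (9*k+4) = pv k" "mate (9*k+5) = qv (9*k-8)"
  "mate (9*k+6) = qv (9*k+2)" "mate (9*k+7) = qv (9*k)" "mate (9*k+8) = qv (9*k+3)"
  by (auto simp: mate_def chord_def)

lemma mate_cases:
  "(\<exists>k. i = 9 * k + 4 \<and> mate i = pv k)
   \<or> (\<exists>j. mate i = qv j \<and> mate j = qv i \<and> j \<notin> {i - 1, i, i + 1} \<and> \<bar>j div 9 - i div 9\<bar> \<le> 1)"
proof (cases i rule: mod9_cases)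
  case (2 k)
  \<comment> \<open>\<open>9*k+14\<close> is residue 5 of the next period: this is the only kind of
    chord that leaves its period.\<close>
  have "mate (9*k+14) = qv (9*k+1)" using mate_simps(6)[of "k+1"] by (simp add: algebra_simps)
  thus ?thesis using 2 by auto
next
  case (6 k)
  have "mate (9*k-8) = qv (9*k+5)" using mate_simps(2)[of "k-1"] by (simp add: algebra_simps)
  thus ?thesis using 6 by auto
qed auto

lemma adj_sym: "adj u v \<Longrightarrow> adj v u"
proof (cases u rule: vertex_cases)
  case (P i)
  assume "adj u v"
  thus ?thesis using P by (auto simp: adj_pv adj_qv)
next
  case (Q i)
  assume "adj u v"
  thus ?thesis using Q mate_cases[of i] by (auto simp: adj_pv adj_qv)
qed

lemma neighbours_distinct:
  "pv (i - 1) \<noteq> pv (i + 1)" "qv (i - 1) \<noteq> qv (i + 1)" "mate i \<noteq> qv (i - 1)" "mate i \<noteq> qv (i + 1)" "qv i \<noteq> mate i"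
  using mate_cases[of i] by auto

lemma simple_adj: "simple_graph adj"
  unfolding simple_graph_def
proof (intro conjI allI impI)
  fix v show "\<not> adj v v"
    by (cases v rule: vertex_cases) (use neighbours_distinct in \<open>auto simp: adj_pv adj_qv\<close>)
qed (rule adj_sym)

lemma neighbours: "{w. adj (pv i) w} = {pv (i - 1), pv (i + 1), qv (9 * i + 4)}"
  "{w. adj (qv i) w} = {qv (i - 1), qv (i + 1), mate i}"
  by (auto simp: adj_pv adj_qv)

lemma vdegree_adj: "vdegree adj v = 3"
proof -
  have "finite {w. adj v w} \<and> card {w. adj v w} = 3"
    by (cases v rule: vertex_cases)
       (use neighbours_distinct in \<open>auto simp: neighbours card_insert_if eq_commute[of "mate _"]\<close>)
  thus ?thesis by (simp add: vdegree_def numeral_eq_enat)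
qed

interpretation G: locally_finite_graph adj
proof
  show "simple_graph adj" by (rule simple_adj)
  fix v show "finite {w. adj v w}"
    by (cases v rule: vertex_cases) (auto simp: neighbours)
qed

section \<open>Levels, the pieces of the chain, and the two ends\<close>

definition lev :: "nat \<Rightarrow> int" where
  "lev v = (if even v then int_decode (v div 2) else int_decode (v div 2) div 9)"

lemma lev_simps [simp]: "lev (pv i) = i" "lev (qv i) = i div 9"
  by (auto simp: lev_def pv_def qv_def)

lemma lev_step: "adj u v \<Longrightarrow> \<bar>lev v - lev u\<bar> \<le> 1"
proof (cases u rule: vertex_cases)
  case (P i)
  assume "adj u v"
  thus ?thesis using P by (auto simp: adj_pv)
next
  case (Q i)
  assume "adj u v"
  then consider "v = qv (i - 1)" | "v = qv (i + 1)" | "v = mate i" using Q by (auto simp: adj_qv)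
  thus ?thesis
  proof cases
    case 3
    thus ?thesis using Q mate_cases[of i] by auto
  qed (use Q in \<open>simp; linarith\<close>)+
qed

lemma finite_lev: "finite {v. \<bar>lev v\<bar> \<le> n}"
proof -
  have "{v. \<bar>lev v\<bar> \<le> n} \<subseteq> pv ` {-n..n} \<union> qv ` {-9*n..9*n+8}"
  proof
    fix v assume "v \<in> {v. \<bar>lev v\<bar> \<le> n}"
    thus "v \<in> pv ` {-n..n} \<union> qv ` {-9*n..9*n+8}"
    proof (cases v rule: vertex_cases)
      case (Q i)
      assume "v \<in> {v. \<bar>lev v\<bar> \<le> n}"
      hence "i div 9 \<le> n" "- n \<le> i div 9" using Q by (auto simp: abs_le_iff)
      hence "i \<in> {-9*n..9*n+8}" by auto
      thus ?thesis using Q by blast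
    qed (auto simp: abs_le_iff)
  qed
  thus ?thesis by (rule finite_subset) auto
qed

text \<open>Level \<open>k\<close> consists of \<open>pv k\<close> and of \<open>qv (9*k)\<close> to
  \<open>qv (9*k+8)\<close>. Into each level there rise one edge of either double ray and one chord
  of length 13.\<close>

lemma level_cut:
  assumes "adj u v" "lev u < k" "k \<le> lev v"
  shows "(u, v) \<in> {(pv (k-1), pv k), (qv (9*k-1), qv (9*k)), (qv (9*k-8), qv (9*k+5))}"
proof (cases u rule: vertex_cases)
  case (P i)
  thus ?thesis using assms by (auto simp: adj_pv)
next
  case (Q i)
  have i: "i div 9 < k" using assms(2) Q by simp
  consider "v = qv (i - 1)" | "v = qv (i + 1)" | "v = mate i" using assms(1) Q by (auto simp: adj_qv)
  thus ?thesis
  proof cases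
    case 1
    thus ?thesis using assms(3) i by simp
  next
    case 2
    hence "k \<le> (i + 1) div 9" using assms(3) by simp
    hence "i + 1 = 9 * k" using i by linarith
    thus ?thesis using 2 Q by auto
  next
    case 3
    show ?thesis by (cases i rule: mod9_cases) (use 3 Q i assms(3) in auto)
  qed
qed

lemma level_cut_edges:
  "cut_edges adj {v. lev v < k} = {(pv (k-1), pv k), (qv (9*k-1), qv (9*k)), (qv (9*k-8), qv (9*k+5))}"
proof
  show "cut_edges adj {v. lev v < k} \<subseteq> {(pv (k-1), pv k), (qv (9*k-1), qv (9*k)), (qv (9*k-8), qv (9*k+5))}"
  proof (rule subrelI)
    fix u v assume "(u, v) \<in> cut_edges adj {v. lev v < k}"
    thus "(u, v) \<in> {(pv (k-1), pv k), (qv (9*k-1), qv (9*k)), (qv (9*k-8), qv (9*k+5))}"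
      by (intro level_cut) (auto simp: cut_edges_def)
  qed
  have "mate (9*k+5) = qv (9*k-8)" by simp
  hence "adj (qv (9*k+5)) (qv (9*k-8))" by (simp only: adj_qv insert_iff simp_thms)
  hence "adj (qv (9*k-8)) (qv (9*k+5))" by (rule adj_sym)
  thus "{(pv (k-1), pv k), (qv (9*k-1), qv (9*k)), (qv (9*k-8), qv (9*k+5))} \<subseteq> cut_edges adj {v. lev v < k}"
    by (auto simp: cut_edges_def adj_pv) (simp add: adj_qv)
qed

text \<open>The sign \<open>\<sigma> = \<plusminus>1\<close> selects the right or the left end.\<close>

definition side :: "int \<Rightarrow> (nat \<Rightarrow> nat) set" where
  "side \<sigma> = {r. is_ray adj r \<and> (\<forall>N. \<exists>n. \<forall>k\<ge>n. N < \<sigma> * lev (r k))}"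

text \<open>A ray leaves every bounded range of levels, since such a range is finite. Once the level
  has absolute value at least 2, steps of size at most 1 cannot change its sign.\<close>

lemma ray_side:
  assumes "is_ray adj r"
  shows "r \<in> side 1 \<or> r \<in> side (-1)"
proof -
  have ev: "\<exists>n. \<forall>k\<ge>n. N < \<bar>lev (r k)\<bar>" for N
    using ray_eventually_avoids[OF assms finite_lev[of N]] by (simp add: not_le)
  obtain n0 where n0: "\<forall>k\<ge>n0. 1 < \<bar>lev (r k)\<bar>" using ev by blast
  have same: "lev (r n0) > 0 \<longleftrightarrow> lev (r k) > 0" if "k \<ge> n0" for k
    using that
  proof (induction k rule: dec_induct)
    case (step k)
    have "\<bar>lev (r (Suc k)) - lev (r k)\<bar> \<le> 1" using assms lev_step by (simp add: is_ray_def)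
    moreover have "1 < \<bar>lev (r k)\<bar>" "1 < \<bar>lev (r (Suc k))\<bar>" using n0 step by auto
    ultimately show ?case using step.IH by linarith
  qed simp
  have tail: "\<exists>n. \<forall>k\<ge>n. N < \<sigma> * lev (r k)" if s: "\<And>k. k \<ge> n0 \<Longrightarrow> \<sigma> * lev (r k) = \<bar>lev (r k)\<bar>" for \<sigma> N
  proof -
    obtain n where "\<forall>k\<ge>n. N < \<bar>lev (r k)\<bar>" using ev by blast
    thus ?thesis using s by (intro exI[of _ "max n n0"]) auto
  qed
  show ?thesis
  proof (cases "lev (r n0) > 0")
    case True
    hence "\<And>k. k \<ge> n0 \<Longrightarrow> 1 * lev (r k) = \<bar>lev (r k)\<bar>" using same by auto
    thus ?thesis using tail[of 1] assms by (auto simp: side_def)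
  next
    case False
    hence "\<And>k. k \<ge> n0 \<Longrightarrow> -1 * lev (r k) = \<bar>lev (r k)\<bar>" using same by fastforce
    thus ?thesis using tail[of "-1"] assms by (auto simp: side_def)
  qed
qed

text \<open>Beyond level \<open>N\<close> the tails of both double rays are untouched by
  \<open>S\<close>, and a vertex of \<open>qv\<close> can walk inside its own level to
  \<open>qv (9*k+4)\<close>, which is matched to \<open>pv k\<close>. Connectedness of the graph,
  equivalence of rays on one side and the neighbourhoods of ends all rest on this.\<close>

lemma reach_beyond:
  assumes \<sigma>: "\<sigma> = 1 \<or> \<sigma> = -1" and S: "\<And>s. s \<in> S \<Longrightarrow> \<sigma> * lev s \<le> N"
    and xy: "N < \<sigma> * lev x" "N < \<sigma> * lev y"
  shows "reach_avoiding adj S x y"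
proof -
  have out: "N < \<sigma> * lev v \<Longrightarrow> v \<notin> S" for v using S by force
  have P: "reach_avoiding adj S (pv i) (pv j)" if "i \<le> j" "N < \<sigma> * i" "N < \<sigma> * j" for i j
    using that
  proof (induction j rule: int_ge_induct)
    case base
    thus ?case using out[of "pv i"] by (simp add: reach_avoiding_def)
  next
    case (step j)
    have "N < \<sigma> * j" using \<sigma> step by auto
    moreover have "reach_avoiding adj S (pv j) (pv (j+1))"
      using out[of "pv j"] out[of "pv (j+1)"] step \<open>N < \<sigma> * j\<close>
      by (intro reach_avoiding_step) (auto simp: adj_pv)
    ultimately show ?case using step reach_avoiding_trans by blast
  qed
  have Q: "reach_avoiding adj S (qv i) (qv j)" if "i \<le> j" "N < \<sigma> * (i div 9)" "N < \<sigma> * (j div 9)" for i j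
    using that
  proof (induction j rule: int_ge_induct)
    case base
    thus ?case using out[of "qv i"] by (simp add: reach_avoiding_def)
  next
    case (step j)
    have "i div 9 \<le> j div 9" "j div 9 \<le> (j + 1) div 9" using step by (auto intro: zdiv_mono1)
    hence "N < \<sigma> * (j div 9)" using \<sigma> step by auto
    moreover have "reach_avoiding adj S (qv j) (qv (j+1))"
      using out[of "qv j"] out[of "qv (j+1)"] step \<open>N < \<sigma> * (j div 9)\<close>
      by (intro reach_avoiding_step) (auto simp: adj_qv)
    ultimately show ?case using step reach_avoiding_trans by blast
  qed
  have to_P: "\<exists>i. N < \<sigma> * i \<and> reach_avoiding adj S v (pv i)" if v: "N < \<sigma> * lev v" for v
  proof (cases v rule: vertex_cases)
    case (P i)
    thus ?thesis using v out[OF v] by (auto simp: reach_avoiding_def)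
  next
    case q: (Q i)
    define k where "k = i div 9"
    have k: "N < \<sigma> * k" using v q k_def by simp
    have "reach_avoiding adj S (qv i) (qv (9*k+4))"
      using Q[of i "9*k+4"] reach_avoiding_sym[OF simple_adj Q[of "9*k+4" i]] k k_def by (cases "i \<le> 9*k+4") auto
    moreover have "reach_avoiding adj S (qv (9*k+4)) (pv k)"
      using out[of "pv k"] out[of "qv (9*k+4)"] k by (intro reach_avoiding_step) (auto simp: adj_qv)
    ultimately show ?thesis using q k reach_avoiding_trans by blast
  qed
  obtain i j where "N < \<sigma> * i" "reach_avoiding adj S x (pv i)" "N < \<sigma> * j" "reach_avoiding adj S y (pv j)"
    using to_P xy by meson
  moreover from this have "reach_avoiding adj S (pv i) (pv j)"
    using P[of i j] P[of j i] reach_avoiding_sym[OF simple_adj] by (metis linear)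
  ultimately show ?thesis using reach_avoiding_trans reach_avoiding_sym[OF simple_adj] by meson
qed

lemma graph_connected_adj: "graph_connected adj"
  unfolding graph_connected_def
proof (intro allI)
  fix u v
  have "reach_avoiding adj {} u v"
    using reach_beyond[of 1 "{}" "min (lev u) (lev v) - 1" u v] by auto
  thus "adj\<^sup>*\<^sup>* u v" by (simp add: reach_avoiding_def)
qed

lemma finite_lev_bound:
  assumes "finite (S :: nat set)"
  obtains N where "\<And>s. s \<in> S \<Longrightarrow> \<sigma> * lev s \<le> N"
proof -
  have "finite ((\<lambda>s. \<sigma> * lev s) ` S)" using assms by simp
  then obtain N where "\<forall>x\<in>(\<lambda>s. \<sigma> * lev s) ` S. x \<le> N"
    using bdd_above_finite bdd_above_def by metis
  thus ?thesis using that by blast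
qed

lemma side_equiv:
  assumes \<sigma>: "\<sigma> = 1 \<or> \<sigma> = -1" and r: "r \<in> side \<sigma>" and s: "s \<in> side \<sigma>"
  shows "rays_equiv adj r s"
  unfolding rays_equiv_def
proof (intro allI impI)
  fix S :: "nat set" assume "finite S"
  then obtain N where N: "\<And>s. s \<in> S \<Longrightarrow> \<sigma> * lev s \<le> N" using finite_lev_bound by blast
  obtain n m where nm: "\<forall>k\<ge>n. N < \<sigma> * lev (r k)" "\<forall>k\<ge>m. N < \<sigma> * lev (s k)"
    using r s unfolding side_def by blast
  have "reach_avoiding adj S (r n) (s m)" by (rule reach_beyond[OF \<sigma> N]) (use nm in auto)
  moreover have "\<forall>k\<ge>n. r k \<notin> S" "\<forall>k\<ge>m. s k \<notin> S" using nm N by (meson not_le)+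
  ultimately show "\<exists>n m. (\<forall>k\<ge>n. r k \<notin> S) \<and> (\<forall>k\<ge>m. s k \<notin> S) \<and> reach_avoiding adj S (r n) (s m)"
    by blast
qed

text \<open>The cut below level 0 is finite, and no path that avoids the end vertices of its edges
  changes sides.\<close>

lemma sides_not_equiv:
  assumes "r \<in> side 1" "s \<in> side (-1)"
  shows "\<not> rays_equiv adj r s"
proof
  assume eq: "rays_equiv adj r s"
  let ?C = "{v. lev v < 0}"
  have "finite (G.cut_ends ?C)" by (rule G.finite_cut_ends) (simp add: level_cut_edges)
  then obtain n m where nm: "\<forall>k\<ge>n. r k \<notin> G.cut_ends ?C" "\<forall>k\<ge>m. s k \<notin> G.cut_ends ?C"
     "reach_avoiding adj (G.cut_ends ?C) (r n) (s m)"
    using eq unfolding rays_equiv_def by blast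
  have "\<exists>n. \<forall>k\<ge>n. 0 < 1 * lev (r k)" "\<exists>n. \<forall>k\<ge>n. 0 < -1 * lev (s k)"
    using assms unfolding side_def by blast+
  then obtain n' m' where *: "\<forall>k\<ge>n'. 0 < lev (r k)" "\<forall>k\<ge>m'. lev (s k) < 0" by auto
  have ray: "is_ray adj r" "is_ray adj s" using assms by (auto simp: side_def)
  have "r n \<in> ?C \<longleftrightarrow> r (max n n') \<in> ?C"
    using G.reach_same_side[OF reach_avoiding_ray[OF ray(1) nm(1)]] by simp
  moreover have "s m \<in> ?C \<longleftrightarrow> s (max m m') \<in> ?C"
    using G.reach_same_side[OF reach_avoiding_ray[OF ray(2) nm(2)]] by simp
  moreover have "0 < lev (r (max n n'))" "lev (s (max m m')) < 0" using * by auto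
  ultimately show False using G.reach_same_side[OF nm(3)] by simp
qed

lemma side_eq:
  assumes \<sigma>: "\<sigma> = 1 \<or> \<sigma> = -1" and r: "r \<in> side \<sigma>"
  shows "{s. is_ray adj s \<and> rays_equiv adj r s} = side \<sigma>"
proof
  show "side \<sigma> \<subseteq> {s. is_ray adj s \<and> rays_equiv adj r s}"
    using side_equiv[OF \<sigma> r] by (auto simp: side_def)
  show "{s. is_ray adj s \<and> rays_equiv adj r s} \<subseteq> side \<sigma>"
  proof
    fix s assume "s \<in> {s. is_ray adj s \<and> rays_equiv adj r s}"
    hence "is_ray adj s" "rays_equiv adj r s" "rays_equiv adj s r"
      using rays_equiv_sym[OF simple_adj] by auto
    thus "s \<in> side \<sigma>" using ray_side[of s] sides_not_equiv r \<sigma> by blast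
  qed
qed

section \<open>Three disjoint rays towards each end\<close>

text \<open>A double ray inside \<open>qv\<close> using every second of the chords \<open>9k+1 -- 9k+14\<close>; its translate by 9 uses
  the others and is disjoint from it.\<close>

definition zig :: "int \<Rightarrow> int" where
  "zig m = 18 * (m div 6) + (if m mod 6 < 2 then m mod 6 else m mod 6 + 12)"

lemma zig_simps: "zig (6*k) = 18*k" "zig (6*k+1) = 18*k+1" "zig (6*k+2) = 18*k+14"
  "zig (6*k+3) = 18*k+15" "zig (6*k+4) = 18*k+16" "zig (6*k+5) = 18*k+17"
  "zig (1+6*k) = 18*k+1" "zig (2+6*k) = 18*k+14"
  "zig (3+6*k) = 18*k+15" "zig (4+6*k) = 18*k+16" "zig (5+6*k) = 18*k+17"
  by (auto simp: zig_def)

lemma mod6_cases: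
  obtains k :: int where "i = 6*k" | k where "i = 6*k+1" | k where "i = 6*k+2" | k where "i = 6*k+3"
  | k where "i = 6*k+4" | k where "i = 6*k+5"
proof -
  have "i = 6 * (i div 6) + i mod 6" by simp
  moreover have "i mod 6 \<in> {0,1,2,3,4,5}"
    using pos_mod_bound[of 6 i] pos_mod_sign[of 6 i] by auto
  ultimately show ?thesis using that by (metis add.right_neutral empty_iff insert_iff)
qed

text \<open>The double ray and its translate move in parallel. The chord from \<open>18*k+1\<close>
  belongs to the even period \<open>2*k\<close>, its translate to the odd period
  \<open>2*k+1\<close>, so the two never compete for a chord.\<close>

lemma zig_step:
  "zig (m + 1) = zig m + 1 \<or>
    mate (zig m) = qv (zig (m + 1)) \<and> mate (zig m + 9) = qv (zig (m + 1) + 9)"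
proof (cases m rule: mod6_cases)
  case (2 k)
  have "mate (18*k+1) = qv (18*k+14)" using mate_simps(2)[of "2*k"] by simp
  moreover have "mate (18*k+10) = qv (18*k+23)" using mate_simps(2)[of "2*k+1"] by (simp add: algebra_simps)
  moreover have "zig m = 18*k+1" using 2 zig_simps(2) by simp
  moreover have "zig (m + 1) = 18*k+14" using 2 zig_simps(3)[of k] by (simp add: add.commute)
  ultimately show ?thesis by (simp add: add.commute)
next
  case (6 k)
  hence "m + 1 = 6*(k+1)" by simp
  hence "zig (m + 1) = zig (6*(k+1))" by (rule arg_cong)
  hence "zig (m + 1) = 18*k+18" using zig_simps(1)[of "k+1"] by simp
  thus ?thesis using 6 zig_simps(6)[of k] by simp
qed (simp_all add: zig_simps)

lemma adj_zig: "adj (qv (zig m)) (qv (zig (m + 1)))" "adj (qv (zig m + 9)) (qv (zig (m + 1) + 9))"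
  using zig_step[of m] by (auto simp: adj_qv)

lemma zig_bounds: "3 * m - 8 \<le> zig m" "zig m \<le> 3 * m + 8"
  by (cases m rule: mod6_cases; simp add: zig_simps)+

lemma zig_inj: "zig m = zig n \<Longrightarrow> m = n"
proof -
  have "m = 6 * (zig m div 18) + (if zig m mod 18 < 2 then zig m mod 18 else zig m mod 18 - 12)" for m
    by (cases m rule: mod6_cases) (simp_all add: zig_simps)
  thus "zig m = zig n \<Longrightarrow> m = n" by metis
qed

lemma zig_shift: "zig m \<noteq> zig n + 9"
proof -
  have "zig m mod 18 \<in> {0,1,14,15,16,17}"
    by (cases m rule: mod6_cases) (simp_all add: zig_simps)
  moreover have "(zig n + 9) mod 18 \<in> {9,10,5,6,7,8}"
  proof (cases n rule: mod6_cases)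
    case (3 k)
    have "18*k+23 = 18*(k+1)+5" by simp
    thus ?thesis using 3 by (simp add: zig_simps mod_add_right_eq[symmetric] mod_add_eq)
  qed (simp_all add: zig_simps)
  ultimately show ?thesis by auto
qed

definition three_rays :: "int \<Rightarrow> nat \<Rightarrow> nat \<Rightarrow> nat" where
  "three_rays \<sigma> i n = (if i = 0 then pv (\<sigma> * int n) else if i = 1 then qv (zig (\<sigma> * int n))
     else qv (zig (\<sigma> * int n) + 9))"

lemma three_rays_side:
  assumes \<sigma>: "\<sigma> = 1 \<or> \<sigma> = -1"
  shows "three_rays \<sigma> i \<in> side \<sigma>"
proof -
  have inj: "inj (three_rays \<sigma> i)"
    using \<sigma> by (auto simp: inj_def three_rays_def dest!: zig_inj)
  have step: "adj (three_rays \<sigma> i n) (three_rays \<sigma> i (Suc n))" for n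
  proof -
    have *: "\<sigma> * int (Suc n) = \<sigma> * int n + 1 \<or> \<sigma> * int n = \<sigma> * int (Suc n) + 1"
      using \<sigma> by auto
    thus ?thesis
    proof
      assume e: "\<sigma> * int (Suc n) = \<sigma> * int n + 1"
      show ?thesis unfolding three_rays_def e using adj_zig by (auto simp: adj_pv)
    next
      assume e: "\<sigma> * int n = \<sigma> * int (Suc n) + 1"
      show ?thesis unfolding three_rays_def e using adj_zig adj_sym by (auto simp: adj_pv)
    qed
  qed
  have far: "\<exists>n. \<forall>k\<ge>n. N < \<sigma> * lev (three_rays \<sigma> i k)" for N
  proof (intro exI allI impI)
    \<comment> \<open>By \<open>zig_bounds\<close> and the translation by 9, step \<open>k\<close>
      lies at least \<open>3*k - 17\<close> positions out along \<open>qv\<close>, and nine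
      positions make a level; 20 leaves room for rounding.\<close>
    fix k assume k: "k \<ge> nat (3 * \<bar>N\<bar> + 20)"
    hence k': "int k \<ge> 3 * \<bar>N\<bar> + 20" by linarith
    have "N < \<sigma> * (\<sigma> * int k)" using \<sigma> k' by auto
    moreover have "N < \<sigma> * (zig (\<sigma> * int k) div 9)" "N < \<sigma> * ((zig (\<sigma> * int k) + 9) div 9)"
      using \<sigma> k' zig_bounds[of "\<sigma> * int k"] by (auto; linarith)+
    ultimately show "N < \<sigma> * lev (three_rays \<sigma> i k)" by (simp add: three_rays_def)
  qed
  show ?thesis using inj step far by (simp add: side_def is_ray_def)
qed

lemma three_rays_disjoint:
  "i < 3 \<Longrightarrow> j < 3 \<Longrightarrow> i \<noteq> j \<Longrightarrow> range (three_rays \<sigma> i) \<inter> range (three_rays \<sigma> j) = {}"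
proof -
  assume ij: "i < 3" "j < 3" "i \<noteq> j"
  have "three_rays \<sigma> i n \<noteq> three_rays \<sigma> j m" for n m
    using ij zig_shift[of "\<sigma> * int n" "\<sigma> * int m"] zig_shift[of "\<sigma> * int m" "\<sigma> * int n"]
    by (simp add: three_rays_def)
  thus ?thesis by blast
qed

lemma is_end_side: "\<sigma> = 1 \<or> \<sigma> = -1 \<Longrightarrow> is_end adj (side \<sigma>)"
  using three_rays_side[of \<sigma> 0] side_eq[of \<sigma> "three_rays \<sigma> 0"]
  unfolding is_end_def by (intro exI[of _ "three_rays \<sigma> 0"]) (auto simp: side_def)

lemma is_end_adj: "is_end adj \<omega> \<longleftrightarrow> \<omega> = side 1 \<or> \<omega> = side (-1)"
proof
  assume "is_end adj \<omega>"
  then obtain r where r: "is_ray adj r" "\<omega> = {s. is_ray adj s \<and> rays_equiv adj r s}"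
    by (auto simp: is_end_def)
  thus "\<omega> = side 1 \<or> \<omega> = side (-1)" using ray_side[OF r(1)] side_eq by metis
qed (use is_end_side in auto)

section \<open>Degrees of the ends\<close>

lemma ray_crosses_level:
  assumes "f 0 < N" "f n \<ge> (N::int)"
  shows "\<exists>k. f k < N \<and> f (Suc k) \<ge> N"
proof (rule ccontr)
  assume "\<not> ?thesis"
  hence "f k < N" for k using assms(1) by (induction k) (auto simp: not_le)
  from this[of n] show False using assms(2) by simp
qed

text \<open>A level cut beyond all the starting vertices must be traversed by every ray of the end.
  Edge-disjoint rays traverse it in different edges, and it has only three.\<close>

lemma edge_disjoint_le_3:
  assumes \<sigma>: "\<sigma> = 1 \<or> \<sigma> = -1" and rs: "\<forall>i<k. rs i \<in> side \<sigma>"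
    and dj: "\<forall>i<k. \<forall>j<k. i \<noteq> j \<longrightarrow> ray_edges (rs i) \<inter> ray_edges (rs j) = {}"
  shows "k \<le> (3::nat)"
proof -
  obtain N where N: "\<And>v. v \<in> (\<lambda>i. rs i 0) ` {..<k} \<Longrightarrow> \<sigma> * lev v \<le> N"
    using finite_lev_bound[of "(\<lambda>i. rs i 0) ` {..<k}" \<sigma>] by blast
  \<comment> \<open>For \<open>\<sigma> = -1\<close> the rays start at levels at least
    \<open>-N\<close> and must descend below that, so the cut separates levels \<open>-N-1\<close>
    and \<open>-N\<close>.\<close>
  define c where "c = (if \<sigma> = 1 then N + 1 else - N)"
  let ?cut = "{(pv (c-1), pv c), (qv (9*c-1), qv (9*c)), (qv (9*c-8), qv (9*c+5))}"
  define D where "D = (\<lambda>(u, v). {u, v}) ` ?cut"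
  have "\<exists>e. e \<in> ray_edges (rs i) \<inter> D" if i: "i < k" for i
  proof -
    have ri: "rs i \<in> side \<sigma>" using rs i by simp
    have "\<sigma> * lev (rs i 0) < N + 1" using N i by force
    moreover obtain n where "\<sigma> * lev (rs i n) \<ge> N + 1"
    proof -
      obtain n where "\<forall>k\<ge>n. N < \<sigma> * lev (rs i k)" using ri unfolding side_def by blast
      hence "N < \<sigma> * lev (rs i n)" by simp
      thus thesis using that[of n] by simp
    qed
    ultimately obtain j where j: "\<sigma> * lev (rs i j) < N + 1" "\<sigma> * lev (rs i (Suc j)) \<ge> N + 1"
      using ray_crosses_level[of "\<lambda>n. \<sigma> * lev (rs i n)" "N+1" n] by blast
    have a: "adj (rs i j) (rs i (Suc j))" using ri by (auto simp: side_def is_ray_def)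
    have "{rs i j, rs i (Suc j)} \<in> D"
    proof (cases "\<sigma> = 1")
      case True
      hence "lev (rs i j) < c" "c \<le> lev (rs i (Suc j))" using j by (auto simp: c_def)
      from level_cut[OF a this] show ?thesis unfolding D_def by (rule rev_image_eqI) simp
    next
      case False
      hence "\<sigma> = -1" using \<sigma> by simp
      hence "lev (rs i (Suc j)) < c" "c \<le> lev (rs i j)" using j by (auto simp: c_def)
      from level_cut[OF adj_sym[OF a] this] show ?thesis
        unfolding D_def by (rule rev_image_eqI) (simp add: insert_commute)
    qed
    thus ?thesis by (auto simp: ray_edges_def)
  qed
  then obtain e where e: "\<And>i. i < k \<Longrightarrow> e i \<in> ray_edges (rs i) \<inter> D" by metis
  have "inj_on e {..<k}"
  proof (rule inj_onI)
    fix i j assume "i \<in> {..<k}" "j \<in> {..<k}" "e i = e j"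
    thus "i = j" using e[of i] e[of j] dj by fastforce
  qed
  moreover have "e ` {..<k} \<subseteq> D" using e by auto
  moreover have "finite D" unfolding D_def by simp
  moreover have "card D \<le> card ?cut" unfolding D_def by (rule card_image_le) simp
  moreover have "card ?cut \<le> 3" by (simp add: card_insert_if)
  ultimately show ?thesis using card_inj_on_le[of e "{..<k}" D] by simp
qed

lemma Sup_enat_eq_3:
  assumes "enat 3 \<in> A" "\<And>x. x \<in> A \<Longrightarrow> x \<le> enat 3"
  shows "Sup A = (3::enat)"
  unfolding numeral_eq_enat using assms by (intro antisym Sup_least Sup_upper)

lemma vertex_disjoint_imp_edge_disjoint:
  "range r \<inter> range s = {} \<Longrightarrow> ray_edges r \<inter> ray_edges s = {}"
proof (rule ccontr)
  assume dj: "range r \<inter> range s = {}" and "ray_edges r \<inter> ray_edges s \<noteq> {}"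
  then obtain n m where "{r n, r (Suc n)} = {s m, s (Suc m)}" by (auto simp: ray_edges_def)
  hence "r n = s m \<or> r n = s (Suc m)" by blast
  thus False using dj by blast
qed

text \<open>Vertex-disjoint rays are edge-disjoint, so the three vertex-disjoint rays and the bound
  by edge cuts settle both degrees together.\<close>

lemma end_degrees:
  assumes \<sigma>: "\<sigma> = 1 \<or> \<sigma> = -1"
  shows "end_vertex_degree adj (side \<sigma>) = 3" "end_edge_degree adj (side \<sigma>) = 3"
proof -
  have dj: "\<forall>i<3. \<forall>j<3. i \<noteq> j \<longrightarrow> range (three_rays \<sigma> i) \<inter> range (three_rays \<sigma> j) = {}"
    using three_rays_disjoint by blast
  have mem: "\<forall>i<3. three_rays \<sigma> i \<in> side \<sigma>" using three_rays_side[OF \<sigma>] by blast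
  show "end_edge_degree adj (side \<sigma>) = 3"
    unfolding end_edge_degree_def
  proof (rule Sup_enat_eq_3)
    have "\<forall>i<3. \<forall>j<3. i \<noteq> j \<longrightarrow> ray_edges (three_rays \<sigma> i) \<inter> ray_edges (three_rays \<sigma> j) = {}"
      using dj vertex_disjoint_imp_edge_disjoint by blast
    thus "enat 3 \<in> {enat k |k. \<exists>rs. (\<forall>i<k. rs i \<in> side \<sigma>) \<and>
      (\<forall>i<k. \<forall>j<k. i \<noteq> j \<longrightarrow> ray_edges (rs i) \<inter> ray_edges (rs j) = {})}"
      using mem by blast
  qed (use edge_disjoint_le_3[OF \<sigma>] in auto)
  show "end_vertex_degree adj (side \<sigma>) = 3"
    unfolding end_vertex_degree_def
  proof (rule Sup_enat_eq_3)
    show "enat 3 \<in> {enat k |k. \<exists>rs. (\<forall>i<k. rs i \<in> side \<sigma>) \<and>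
      (\<forall>i<k. \<forall>j<k. i \<noteq> j \<longrightarrow> range (rs i) \<inter> range (rs j) = {})}"
      using mem dj by blast
    fix x assume "x \<in> {enat k |k. \<exists>rs. (\<forall>i<k. rs i \<in> side \<sigma>) \<and>
      (\<forall>i<k. \<forall>j<k. i \<noteq> j \<longrightarrow> range (rs i) \<inter> range (rs j) = {})}"
    then obtain k rs where "x = enat k" "\<forall>i<k. rs i \<in> side \<sigma>"
      "\<forall>i<k. \<forall>j<k. i \<noteq> j \<longrightarrow> range (rs i) \<inter> range (rs j) = {}" by blast
    thus "x \<le> enat 3"
      using edge_disjoint_le_3[OF \<sigma>, of k rs] vertex_disjoint_imp_edge_disjoint by simp
  qed
qed

section \<open>Edges of a Hamilton circle\<close>

lemma mid_commute: "mid (u, v) = mid (v, u)"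
  by (simp add: mid_def min.commute max.commute)

context
  fixes H assumes ham: "hamilton_circle adj H"
begin

definition uses_P :: "int \<Rightarrow> bool" where "uses_P i \<longleftrightarrow> mid (pv i, pv (i + 1)) \<in> H"
definition uses_Q :: "int \<Rightarrow> bool" where "uses_Q i \<longleftrightarrow> mid (qv i, qv (i + 1)) \<in> H"
definition uses_mate :: "int \<Rightarrow> bool" where "uses_mate i \<longleftrightarrow> mid (qv i, mate i) \<in> H"

text \<open>A chord has two names, one from each end. Residues 5 to 8 are rewritten to residues 0 to
  3, so that every edge becomes a single propositional atom.\<close>

lemma uses_mate_simps:
  "uses_mate (9*k+4) \<longleftrightarrow> mid (pv k, qv (9*k+4)) \<in> H"
  "uses_mate (9*k+5) = uses_mate (9*(k-1)+1)" "uses_mate (9*k+6) = uses_mate (9*k+2)" "uses_mate (9*k+7) = uses_mate (9*k)" "uses_mate (9*k+8) = uses_mate (9*k+3)"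
proof -
  show "uses_mate (9*k+5) = uses_mate (9*(k-1)+1)"
  proof -
    have "uses_mate (9*k+5) \<longleftrightarrow> mid (qv (9*k+5), qv (9*k-8)) \<in> H" by (simp add: uses_mate_def)
    moreover have "9*k-8 = 9*(k-1)+1" "9*k+5 = 9*(k-1)+14" by simp_all
    ultimately show ?thesis by (simp only: uses_mate_def mate_simps mid_commute)
  qed
qed (simp_all add: uses_mate_def mid_commute)

lemma two_at_P: "two_of_three (uses_P (i - 1)) (uses_P i) (uses_mate (9*i+4))"
proof -
  have "cut_edges adj {pv i} = {(pv i, pv (i - 1)), (pv i, pv (i + 1)), (pv i, qv (9*i+4))}"
    by (auto simp: cut_edges_def adj_pv)
  from G.ham_three_cut_two[OF ham this] show ?thesis
    by (simp add: uses_P_def uses_mate_simps mid_commute[of "pv i" "pv (i - 1)"])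
qed

lemma two_at_Q: "two_of_three (uses_Q (i - 1)) (uses_Q i) (uses_mate i)"
proof -
  have "cut_edges adj {qv i} = {(qv i, qv (i - 1)), (qv i, qv (i + 1)), (qv i, mate i)}"
    using neighbours_distinct[of i] by (auto simp: cut_edges_def adj_qv)
  from G.ham_three_cut_two[OF ham this] show ?thesis
    using neighbours_distinct[of i]
    by (auto simp: uses_Q_def uses_mate_def mid_commute[of "qv i" "qv (i - 1)"])
qed

text \<open>This is the degree condition at the vertex obtained by contracting all levels below
  \<open>k\<close>, with the chord named from its lower end.\<close>

lemma two_at_level: "two_of_three (uses_P (k - 1)) (uses_Q (9*k-1)) (uses_mate (9*(k-1)+1))"
proof -
  have "mate (9*(k-1)+1) = qv (9*k+5)" using mate_simps(2)[of "k-1"] by (simp add: algebra_simps)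
  thus ?thesis
    using G.ham_three_cut_two[OF ham level_cut_edges[of k]] by (simp add: uses_P_def uses_Q_def uses_mate_def algebra_simps)
qed

lemma cut_crossed:
  assumes "cut_edges adj C \<subseteq> D" "finite D" "u \<in> C" "v \<notin> C"
  shows "\<exists>e\<in>D. mid e \<in> H"
  \<comment> \<open>A single crossing is wanted here, so the excluded edge may be arbitrary.\<close>
  using G.ham_cut_crossed[OF ham, of C undefined] assms finite_subset by blast

text \<open>Contracting the levels below and above \<open>k\<close> to two vertices turns level \<open>k\<close> into a cubic graph
  with nine 2-factors. The four of them that miss one of the edges in \<open>forced\<close> are disconnected; each
  is excluded by one of the following four cuts.\<close>

lemma cut_1: "uses_Q (9*k-1) \<or> uses_mate (9*k+1) \<or> uses_Q (9*k+2) \<or> uses_Q (9*k+5) \<or> uses_Q (9*k+7)"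
proof -
  \<comment> \<open>The chords from residue 0 to 7 and from 2 to 6 make a 5-cycle 0, 1, 2, 6, 7,
    whose boundary is \<open>?D\<close>. A 2-factor avoiding \<open>?D\<close> has it as a
    component.\<close>
  let ?D = "{(qv (9*k), qv (9*k-1)), (qv (9*k+1), qv (9*k+14)), (qv (9*k+2), qv (9*k+3)),
    (qv (9*k+6), qv (9*k+5)), (qv (9*k+7), qv (9*k+8))}"
  have "\<exists>e\<in>?D. mid e \<in> H"
  proof (rule cut_crossed)
    show "cut_edges adj {qv (9*k), qv (9*k+1), qv (9*k+2), qv (9*k+6), qv (9*k+7)} \<subseteq> ?D"
      by (rule subrelI) (auto simp: cut_edges_def adj_qv)
    show "pv k \<notin> {qv (9*k), qv (9*k+1), qv (9*k+2), qv (9*k+6), qv (9*k+7)}" by simp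
  qed auto
  moreover have "uses_mate (9*k+1) \<longleftrightarrow> mid (qv (9*k+1), qv (9*k+14)) \<in> H" by (simp add: uses_mate_def)
  ultimately show ?thesis by (auto simp: uses_Q_def mid_commute add.commute)
qed

text \<open>The contracted left side is represented by all levels below \<open>k\<close>, which are
  joined to \<open>A\<close>. The cut then consists of the edges rising from \<open>A\<close> and of
  those edges of the level cut that do not end in \<open>A\<close>.\<close>

lemma level_cut_crossed:
  assumes "\<And>u v. u \<in> A \<Longrightarrow> adj u v \<Longrightarrow> v \<notin> A \<Longrightarrow> k \<le> lev v \<Longrightarrow> (u, v) \<in> D"
    and "{(pv (k-1), pv k), (qv (9*k-1), qv (9*k)), (qv (9*k-8), qv (9*k+5))} \<subseteq> D \<union> {e. snd e \<in> A}"
    and "finite D" "pv k \<in> A" "pv (k+1) \<notin> A"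
  shows "\<exists>e\<in>D. mid e \<in> H"
proof (rule cut_crossed)
  show "cut_edges adj ({v. lev v < k} \<union> A) \<subseteq> D"
  proof (rule subrelI)
    fix u v assume "(u, v) \<in> cut_edges adj ({v. lev v < k} \<union> A)"
    hence *: "adj u v" "lev u < k \<or> u \<in> A" "k \<le> lev v" "v \<notin> A" by (auto simp: cut_edges_def)
    show "(u, v) \<in> D"
    proof (cases "lev u < k")
      case True
      thus ?thesis using level_cut[OF *(1) True *(3)] assms(2) *(4) by fastforce
    next
      case False
      thus ?thesis using * assms(1) by blast
    qed
  qed
  show "pv (k+1) \<notin> {v. lev v < k} \<union> A" "pv k \<in> {v. lev v < k} \<union> A" using assms(4,5) by auto
qed (rule assms(3))

text \<open>Together with the contracted left side, \<open>A\<close> carries a 7-cycle: left side,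
  \<open>pv k\<close>, then residues 4, 3, 2, 6, 5. It is a component of the 2-factor excluded
  here.\<close>

lemma cut_2: "uses_Q (9*k-1) \<or> uses_Q (9*k+1) \<or> uses_Q (9*k+6) \<or> uses_mate (9*k+3) \<or> uses_P k"
proof -
  let ?D = "{(qv (9*k-1), qv (9*k)), (qv (9*k+2), qv (9*k+1)), (qv (9*k+6), qv (9*k+7)),
    (qv (9*k+3), qv (9*k+8)), (pv k, pv (k+1))}"
  have "\<exists>e\<in>?D. mid e \<in> H"
    by (rule level_cut_crossed[where k = k and A = "{pv k, qv (9*k+2), qv (9*k+3), qv (9*k+4), qv (9*k+5), qv (9*k+6)}"])
       (auto simp: adj_qv adj_pv)
  moreover have "uses_mate (9*k+3) \<longleftrightarrow> mid (qv (9*k+3), qv (9*k+8)) \<in> H" by (simp add: uses_mate_def)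
  ultimately show ?thesis by (auto simp: uses_Q_def uses_P_def mid_commute add.commute)
qed

text \<open>The excluded component is the 4-cycle through the left side, \<open>pv k\<close> and
  residues 4 and 5.\<close>

lemma cut_3: "uses_Q (9*k-1) \<or> uses_Q (9*k+3) \<or> uses_Q (9*k+5) \<or> uses_P k"
proof -
  let ?D = "{(qv (9*k-1), qv (9*k)), (qv (9*k+4), qv (9*k+3)), (qv (9*k+5), qv (9*k+6)), (pv k, pv (k+1))}"
  have "\<exists>e\<in>?D. mid e \<in> H"
    by (rule level_cut_crossed[where k = k and A = "{pv k, qv (9*k+4), qv (9*k+5)}"])
       (auto simp: adj_qv adj_pv)
  thus ?thesis by (auto simp: uses_Q_def uses_P_def mid_commute add.commute)
qed

text \<open>The excluded component is the 7-cycle through the left side, \<open>pv k\<close> and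
  residues 4, 5, 6, 7, 0. Unlike in the other three cuts, the 2-factor excluded here uses
  \<open>uses_Q (9*k-1)\<close> and misses only \<open>uses_P k\<close>.\<close>

lemma cut_4: "uses_Q (9*k) \<or> uses_Q (9*k+3) \<or> uses_Q (9*k+7) \<or> uses_mate (9*k+2) \<or> uses_P k"
proof -
  let ?D = "{(qv (9*k), qv (9*k+1)), (qv (9*k+4), qv (9*k+3)), (qv (9*k+7), qv (9*k+8)),
    (qv (9*k+6), qv (9*k+2)), (pv k, pv (k+1))}"
  have "\<exists>e\<in>?D. mid e \<in> H"
    by (rule level_cut_crossed[where k = k and A = "{pv k, qv (9*k), qv (9*k+4), qv (9*k+5), qv (9*k+6), qv (9*k+7)}"])
       (auto simp: adj_qv adj_pv)
  moreover have "uses_mate (9*k+2) \<longleftrightarrow> mid (qv (9*k+2), qv (9*k+6)) \<in> H" by (simp add: uses_mate_def)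
  ultimately show ?thesis by (auto simp: uses_Q_def uses_P_def mid_commute add.commute)
qed

text \<open>These are the degree conditions at the twelve vertices of the contracted piece, with one
  name per edge; the last two belong to the contracted sides.\<close>

lemma piece_vertices:
  "two_of_three (uses_Q (9*k-1)) (uses_Q (9*k)) (uses_mate (9*k))"
  "two_of_three (uses_Q (9*k)) (uses_Q (9*k+1)) (uses_mate (9*k+1))"
  "two_of_three (uses_Q (9*k+1)) (uses_Q (9*k+2)) (uses_mate (9*k+2))"
  "two_of_three (uses_Q (9*k+2)) (uses_Q (9*k+3)) (uses_mate (9*k+3))"
  "two_of_three (uses_Q (9*k+3)) (uses_Q (9*k+4)) (uses_mate (9*k+4))"
  "two_of_three (uses_Q (9*k+4)) (uses_Q (9*k+5)) (uses_mate (9*(k-1)+1))"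
  "two_of_three (uses_Q (9*k+5)) (uses_Q (9*k+6)) (uses_mate (9*k+2))"
  "two_of_three (uses_Q (9*k+6)) (uses_Q (9*k+7)) (uses_mate (9*k))"
  "two_of_three (uses_Q (9*k+7)) (uses_Q (9*k+8)) (uses_mate (9*k+3))"
  "two_of_three (uses_P (k-1)) (uses_P k) (uses_mate (9*k+4))"
  "two_of_three (uses_P (k-1)) (uses_Q (9*k-1)) (uses_mate (9*(k-1)+1))"
  "two_of_three (uses_P k) (uses_Q (9*k+8)) (uses_mate (9*k+1))"
proof -
  have step: "9*k+1-1 = 9*k" "9*k+2-1 = 9*k+1" "9*k+3-1 = 9*k+2" "9*k+4-1 = 9*k+3" "9*k+5-1 = 9*k+4"
    "9*k+6-1 = 9*k+5" "9*k+7-1 = 9*k+6" "9*k+8-1 = 9*k+7" "9*(k+1)-1 = 9*k+8" "k+1-1 = k"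
    by simp_all
  show "two_of_three (uses_Q (9*k-1)) (uses_Q (9*k)) (uses_mate (9*k))" by (rule two_at_Q)
  show "two_of_three (uses_Q (9*k)) (uses_Q (9*k+1)) (uses_mate (9*k+1))" using two_at_Q[of "9*k+1"] unfolding step .
  show "two_of_three (uses_Q (9*k+1)) (uses_Q (9*k+2)) (uses_mate (9*k+2))" using two_at_Q[of "9*k+2"] unfolding step .
  show "two_of_three (uses_Q (9*k+2)) (uses_Q (9*k+3)) (uses_mate (9*k+3))" using two_at_Q[of "9*k+3"] unfolding step .
  show "two_of_three (uses_Q (9*k+3)) (uses_Q (9*k+4)) (uses_mate (9*k+4))" using two_at_Q[of "9*k+4"] unfolding step .
  show "two_of_three (uses_Q (9*k+4)) (uses_Q (9*k+5)) (uses_mate (9*(k-1)+1))" using two_at_Q[of "9*k+5"] unfolding step uses_mate_simps .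
  show "two_of_three (uses_Q (9*k+5)) (uses_Q (9*k+6)) (uses_mate (9*k+2))" using two_at_Q[of "9*k+6"] unfolding step uses_mate_simps .
  show "two_of_three (uses_Q (9*k+6)) (uses_Q (9*k+7)) (uses_mate (9*k))" using two_at_Q[of "9*k+7"] unfolding step uses_mate_simps .
  show "two_of_three (uses_Q (9*k+7)) (uses_Q (9*k+8)) (uses_mate (9*k+3))" using two_at_Q[of "9*k+8"] unfolding step uses_mate_simps .
  show "two_of_three (uses_P (k-1)) (uses_P k) (uses_mate (9*k+4))" by (rule two_at_P)
  show "two_of_three (uses_P (k-1)) (uses_Q (9*k-1)) (uses_mate (9*(k-1)+1))" by (rule two_at_level)
  show "two_of_three (uses_P k) (uses_Q (9*k+8)) (uses_mate (9*k+1))" using two_at_level[of "k+1"] unfolding step .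
qed

text \<open>A purely propositional consequence: the degree conditions describe the 2-factors of the
  contracted piece, and the four cuts remove those that miss one of the two edges.\<close>

lemma forced: "uses_Q (9*k-1) \<and> uses_P k"
  using piece_vertices[of k] cut_1[of k] cut_2[of k] cut_3[of k] cut_4[of k]
  unfolding two_of_three_def by argo

lemma all_forced: "uses_P i" "uses_Q i" "\<not> uses_mate i"
proof -
  have P: "uses_P k" for k using forced by blast
  have piece: "(\<forall>j\<in>{0,1,2,3,4,5,6,7,8}. uses_Q (9*k+j) \<and> \<not> uses_mate (9*k+j))" for k
  proof -
    \<comment> \<open>The edge of \<open>qv\<close> leaving this piece is the one entering the next
      piece.\<close>
    have "uses_Q (9*k+8)" using forced[of "k+1"] by (simp add: algebra_simps)
    thus ?thesis
      using piece_vertices[of k] forced[of k] P[of "k-1"] unfolding two_of_three_def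
      by (auto simp: uses_mate_simps)
  qed
  show "uses_P i" by (rule P)
  show "uses_Q i" "\<not> uses_mate i" by (cases i rule: mod9_cases; use piece in fastforce)+
qed

end

section \<open>The Hamilton circle\<close>

text \<open>Unit time per edge. \<open>EPt\<close> names the smaller end vertex first, so the
  parameter is reversed wherever the numbering decreases along \<open>w\<close>.\<close>

definition line :: "(int \<Rightarrow> nat) \<Rightarrow> real \<Rightarrow> fpoint" where
  "line w x = (if x = of_int \<lfloor>x\<rfloor> then Vtx (w \<lfloor>x\<rfloor>)
     else if w \<lfloor>x\<rfloor> < w (\<lfloor>x\<rfloor> + 1) then EPt (w \<lfloor>x\<rfloor>) (w (\<lfloor>x\<rfloor> + 1)) (x - of_int \<lfloor>x\<rfloor>)
     else EPt (w (\<lfloor>x\<rfloor> + 1)) (w \<lfloor>x\<rfloor>) (1 - (x - of_int \<lfloor>x\<rfloor>)))"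

lemma line_of_int [simp]: "line w (of_int i) = Vtx (w i)"
  by (simp add: line_def)

lemma line_between:
  assumes "of_int i < x" "x < of_int i + 1"
  shows "line w x = (if w i < w (i + 1) then EPt (w i) (w (i + 1)) (x - of_int i)
     else EPt (w (i + 1)) (w i) (1 - (x - of_int i)))"
proof -
  have "\<lfloor>x\<rfloor> = i" using assms by linarith
  thus ?thesis using assms by (simp add: line_def)
qed

lemma real_cases_int:
  obtains (int) i where "x = of_int i" | (between) i where "of_int i < x" "x < of_int i + (1::real)"
  by (metis floor_less_iff less_eq_real_def of_int_floor_le floor_less_cancel lessI not_le real_of_int_floor_add_one_gt)

lemma line_inj:
  assumes "inj w" "line w x = line w y"
  shows "x = y"
proof (cases x rule: real_cases_int)
  case i: (int i)
  show ?thesis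
    by (cases y rule: real_cases_int) (use assms i in \<open>auto simp: line_between inj_eq split: if_splits\<close>)
next
  case i: (between i)
  show ?thesis
  proof (cases y rule: real_cases_int)
    case (int j)
    thus ?thesis using assms i by (auto simp: line_between split: if_splits)
  next
    case j: (between j)
    have "{w i, w (i + 1)} = {w j, w (j + 1)}"
      using assms(2) i j by (auto simp: line_between split: if_splits)
    hence "i = j" using assms(1) by (auto simp: doubleton_eq_iff inj_eq)
    thus ?thesis using assms(2) i j by (auto simp: line_between split: if_splits)
  qed
qed

lemma line_disjoint:
  assumes "range w \<inter> range w' = {}"
  shows "line w x \<noteq> line w' y"
proof
  have ne: "w i \<noteq> w' j" for i j using assms by blast
  assume "line w x = line w' y"
  thus False
    by (cases x rule: real_cases_int; cases y rule: real_cases_int)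
       (use ne in \<open>auto simp: line_between split: if_splits\<close>)
qed

lemma line_neq_EndPt: "line w x \<noteq> EndPt \<omega>"
  by (simp add: line_def)

lemma (in locally_finite_graph) line_topspace:
  assumes w: "\<And>i. E (w i) (w (i + 1))"
  shows "line w x \<in> topspace X"
proof (cases x rule: real_cases_int)
  case (between i)
  have "w i \<noteq> w (i + 1)" using w[of i] irrefl by metis
  thus ?thesis using between w[of i] sym[OF w[of i]] by (auto simp: line_between)
qed simp

text \<open>Inside an edge the curve is the parametrization of the edge after an affine map. At a
  vertex, a star of radius \<open>e\<close> allows radius \<open>e\<close> in time; a neighbourhood
  of an end that contains the vertex contains all inner points of its edges and allows radius
  1.\<close>

lemma (in locally_finite_graph) continuous_line:
  assumes w: "\<And>i. E (w i) (w (i + 1))"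
  shows "continuous_map euclidean X (line w)"
  unfolding freudenthal_def
proof (rule continuous_on_generated_topo)
  fix B assume B: "B \<in> edge_interval_nbhds E \<union> vertex_star_nbhds E \<union> end_nbhds E"
  have opB: "openin X B" using B unfolding freudenthal_def by (rule topology_generated_by_Basis)
  have "open (line w -` B)"
  proof (subst open_subopen, intro ballI)
    fix x assume x: "x \<in> line w -` B"
    show "\<exists>T. open T \<and> x \<in> T \<and> T \<subseteq> line w -` B"
    proof (cases x rule: real_cases_int)
      case (between i)
      have ne: "w i \<noteq> w (i + 1)" using w[of i] irrefl by metis
      define u v where "u = min (w i) (w (i + 1))" and "v = max (w i) (w (i + 1))"
      define g :: "real \<Rightarrow> real" where "g y = (if w i < w (i + 1) then y - of_int i else 1 - (y - of_int i))" for y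
      have uv: "u < v" "E u v"
        using ne w[of i] sym[OF w[of i]] by (auto simp: u_def v_def min_def max_def)
      have line: "line w y = EPt u v (g y)" if "of_int i < y" "y < of_int i + 1" for y
        using line_between[OF that] by (auto simp: u_def v_def g_def)
      have "openin (top_of_set {0<..<1}) {t \<in> topspace (top_of_set {0<..<1}). EPt u v t \<in> B}"
        using continuous_EPt[OF uv] opB by (rule openin_continuous_map_preimage)
      hence op: "open {t \<in> {0<..<1}. EPt u v t \<in> B}" using openin_open_eq[of "{0<..<1::real}"] by simp
      have cont: "continuous_on UNIV g"
        by (cases "w i < w (i + 1)") (auto simp: g_def intro!: continuous_intros)
      have g01: "0 < g y \<and> g y < 1 \<longleftrightarrow> of_int i < y \<and> y < of_int i + 1" for y by (auto simp: g_def)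
      show ?thesis
      proof (intro exI conjI)
        show "open (g -` {t \<in> {0<..<1}. EPt u v t \<in> B})" using op cont by (rule open_vimage)
        show "x \<in> g -` {t \<in> {0<..<1}. EPt u v t \<in> B}" using x between line g01[of x] by auto
        show "g -` {t \<in> {0<..<1}. EPt u v t \<in> B} \<subseteq> line w -` B"
        proof
          fix y assume "y \<in> g -` {t \<in> {0<..<1}. EPt u v t \<in> B}"
          hence "0 < g y \<and> g y < 1" "EPt u v (g y) \<in> B" by auto
          thus "y \<in> line w -` B" using line[of y] g01[of y] by simp
        qed
      qed
    next
      case (int i)
      hence v: "Vtx (w i) \<in> B" using x by simp
      have near: "\<exists>T. open T \<and> x \<in> T \<and> T \<subseteq> line w -` B"
        if e: "0 < e" "e \<le> 1" and r: "\<And>y. of_int i < y \<Longrightarrow> y < of_int i + e \<Longrightarrow> line w y \<in> B"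
          and l: "\<And>y. of_int i - e < y \<Longrightarrow> y < of_int i \<Longrightarrow> line w y \<in> B" for e
      proof (intro exI conjI)
        show "open {of_int i - e<..<of_int i + e}" by simp
        show "x \<in> {of_int i - e<..<of_int i + e}" using int e by simp
        show "{of_int i - e<..<of_int i + e} \<subseteq> line w -` B"
        proof
          fix y assume y: "y \<in> {of_int i - e<..<of_int i + e}"
          consider "y < of_int i" | "y = of_int i" | "y > of_int i" by linarith
          thus "y \<in> line w -` B" using y r[of y] l[of y] v by cases auto
        qed
      qed
      have ne: "w j \<noteq> w (j + 1)" for j using w[of j] irrefl by metis
      have right: "line w y = (if w i < w (i + 1) then EPt (w i) (w (i + 1)) (y - of_int i)
          else EPt (w (i + 1)) (w i) (1 - (y - of_int i)))" if "of_int i < y" "y < of_int i + 1" for y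
        using line_between[OF that] .
      have left: "line w y = (if w (i - 1) < w i then EPt (w (i - 1)) (w i) (1 - (of_int i - y))
          else EPt (w i) (w (i - 1)) (of_int i - y))" if "of_int i - 1 < y" "y < of_int i" for y
        using line_between[of "i - 1" y w] that by (simp add: algebra_simps)
      have edges: "w i < w (i + 1) \<or> w (i + 1) < w i" "w (i - 1) < w i \<or> w i < w (i - 1)"
        "E (w i) (w (i + 1))" "E (w (i + 1)) (w i)" "E (w (i - 1)) (w i)" "E (w i) (w (i - 1))"
        using ne[of i] ne[of "i - 1"] w[of i] w[of "i - 1"] sym by (auto simp: neq_iff)
      consider "B \<in> vertex_star_nbhds E" | "B \<in> end_nbhds E"
        using B v by (auto simp: edge_interval_nbhds_def)
      thus ?thesis
      proof cases
        case 1
        then obtain x' e where B': "B = {Vtx x'} \<union> {EPt u w t | u w t. u < w \<and> E u w \<and> 0 < t \<and> t < 1 \<and>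
          ((u = x' \<and> t < e) \<or> (w = x' \<and> 1 - e < t))}" and e: "0 < e" "e \<le> 1"
          by (auto simp: vertex_star_nbhds_def)
        have x': "x' = w i" using v B' by auto
        show ?thesis
        proof (rule near[OF e])
          fix y :: real assume "of_int i < y" "y < of_int i + e"
          thus "line w y \<in> B" using right[of y] e edges by (auto simp: B' x')
        next
          fix y :: real assume "of_int i - e < y" "y < of_int i"
          thus "line w y \<in> B" using left[of y] e edges by (auto simp: B' x')
        qed
      next
        case 2
        then obtain S \<omega> where B': "B = end_nbhd E S \<omega>" by (auto simp: end_nbhds_def)
        have C: "w i \<in> end_component E S \<omega>" using v by (auto simp: B' end_nbhd_def Let_def)
        show ?thesis
        proof (rule near[of 1])
          fix y :: real assume "of_int i < y" "y < of_int i + 1"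
          thus "line w y \<in> B" using right[of y] C edges by (auto simp: B' end_nbhd_def Let_def)
        next
          fix y :: real assume "of_int i - 1 < y" "y < of_int i"
          thus "line w y \<in> B" using left[of y] C edges by (auto simp: B' end_nbhd_def Let_def)
        qed auto
      qed
    qed
  qed
  thus "openin euclidean (line w -` B \<inter> topspace euclidean)" by simp
next
  have "range (line w) \<subseteq> topspace X" using line_topspace[of w] w by blast
  thus "line w ` topspace euclidean \<subseteq> \<Union> (edge_interval_nbhds E \<union> vertex_star_nbhds E \<union> end_nbhds E)"
    by (simp add: freudenthal_def topology_generated_by_topspace)
qed

lemma EPt_in_line:
  assumes "EPt u v t \<in> range (line w)"
  shows "\<exists>i. u = w i \<and> v = w (i + 1) \<or> u = w (i + 1) \<and> v = w i"
proof -
  obtain x where "EPt u v t = line w x" using assms by blast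
  thus ?thesis by (cases x rule: real_cases_int) (auto simp: line_between split: if_splits)
qed

lemma line_covers_edge:
  assumes "u = w i \<and> v = w (i + 1) \<or> u = w (i + 1) \<and> v = w i" "u < v" "0 < t" "t < 1"
  shows "EPt u v t \<in> range (line w)"
proof -
  have "EPt u v t = line w (of_int i + (if u = w i then t else 1 - t))"
    using assms line_between[of i "of_int i + t" w] line_between[of i "of_int i + (1 - t)" w] by auto
  thus ?thesis by blast
qed

section \<open>Wrapping the unit circle around both double rays and both ends\<close>

abbreviation unit_circle :: "complex set" where
  "unit_circle \<equiv> sphere 0 1"

text \<open>The upper half circle is wrapped onto the double ray \<open>pv\<close>, the lower one onto \<open>qv\<close>,
  both by the cotangent of the angle.\<close>

definition wrap :: "complex \<Rightarrow> fpoint" where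
  "wrap z = (if Im z = 0 then EndPt (side (if Re z > 0 then 1 else -1))
     else line (if Im z > 0 then pv else qv) (Re z / \<bar>Im z\<bar>))"

lemma circle_iff: "z \<in> unit_circle \<longleftrightarrow> (Re z)\<^sup>2 + (Im z)\<^sup>2 = 1"
  by (simp add: norm_complex_def)

lemma adj_consecutive: "adj (pv i) (pv (i + 1))" "adj (qv i) (qv (i + 1))"
  by (auto simp: adj_pv adj_qv)

text \<open>By \<open>reach_beyond\<close> everything past the levels of \<open>S\<close> is
  connected, so one vertex of a ray that is far enough out brings all of it into the
  component.\<close>

lemma component_tail:
  assumes \<sigma>: "\<sigma> = 1 \<or> \<sigma> = -1" and S: "finite S" and \<omega>: "EndPt (side \<sigma>) \<in> end_nbhd adj S \<omega>"
  shows "\<exists>M. \<forall>v. M < \<sigma> * lev v \<longrightarrow> v \<in> end_component adj S \<omega>"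
proof -
  let ?C = "end_component adj S \<omega>"
  obtain r n where r: "r \<in> side \<sigma>" "\<forall>k\<ge>n. r k \<in> ?C"
    using \<omega> by (auto simp: end_nbhd_def Let_def)
  obtain M where M: "\<And>s. s \<in> S \<Longrightarrow> \<sigma> * lev s \<le> M" using finite_lev_bound[OF S] by blast
  obtain m where m: "\<forall>k\<ge>m. M < \<sigma> * lev (r k)" using r(1) unfolding side_def by blast
  define x where "x = r (max n m)"
  have x: "x \<in> ?C" "M < \<sigma> * lev x" using r m by (auto simp: x_def)
  have "v \<in> ?C" if "M < \<sigma> * lev v" for v
  proof -
    have "reach_avoiding adj S x v" using reach_beyond[OF \<sigma> M x(2) that] .
    thus ?thesis using x(1) unfolding end_component_def mem_Collect_eq using reach_avoiding_trans by meson
  qed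
  thus ?thesis by blast
qed

lemma line_tail:
  assumes \<sigma>: "\<sigma> = 1 \<or> \<sigma> = -1" and S: "finite S" and \<omega>: "EndPt (side \<sigma>) \<in> end_nbhd adj S \<omega>"
  shows "\<exists>N\<ge>0. \<forall>x. N < of_int \<sigma> * x \<longrightarrow> line pv x \<in> end_nbhd adj S \<omega> \<and> line qv x \<in> end_nbhd adj S \<omega>"
proof -
  obtain M where M: "\<And>v. M < \<sigma> * lev v \<Longrightarrow> v \<in> end_component adj S \<omega>"
    using component_tail[OF assms] by blast
  have line_in: "line w x \<in> end_nbhd adj S \<omega>"
    if "w \<lfloor>x\<rfloor> \<in> end_component adj S \<omega>" "adj (w \<lfloor>x\<rfloor>) (w (\<lfloor>x\<rfloor> + 1))" for w x
  proof -
    have "w \<lfloor>x\<rfloor> \<noteq> w (\<lfloor>x\<rfloor> + 1)" using that(2) G.irrefl by metis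
    moreover have "x - of_int \<lfloor>x\<rfloor> < 1" "x \<noteq> of_int \<lfloor>x\<rfloor> \<Longrightarrow> of_int \<lfloor>x\<rfloor> < x" by linarith+
    ultimately show ?thesis
      using that adj_sym[OF that(2)] by (auto simp: line_def end_nbhd_def Let_def)
  qed
  \<comment> \<open>Nine vertices of \<open>qv\<close> per level account for the factor 9; the
    summand 18 absorbs the rounding by floor and by \<open>div\<close>.\<close>
  have "line pv x \<in> end_nbhd adj S \<omega> \<and> line qv x \<in> end_nbhd adj S \<omega>"
    if x: "9 * \<bar>of_int M\<bar> + 18 < of_int \<sigma> * x" for x
  proof -
    have "M < \<sigma> * \<lfloor>x\<rfloor>" "M < \<sigma> * (\<lfloor>x\<rfloor> div 9)"
    proof -
      have "9 * \<bar>M\<bar> + 17 < \<sigma> * \<lfloor>x\<rfloor>" using \<sigma> x by (elim disjE; simp; linarith)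
      thus "M < \<sigma> * \<lfloor>x\<rfloor>" "M < \<sigma> * (\<lfloor>x\<rfloor> div 9)" using \<sigma> by (elim disjE; simp; linarith)+
    qed
    thus ?thesis using line_in M adj_consecutive by simp
  qed
  thus ?thesis by (intro exI[of _ "9 * \<bar>of_int M\<bar> + 18"]) auto
qed

lemma continuous_wrap: "continuous_map (top_of_set unit_circle) (freudenthal adj) wrap"
  unfolding freudenthal_def
proof (rule continuous_on_generated_topo)
  fix B assume B: "B \<in> edge_interval_nbhds adj \<union> vertex_star_nbhds adj \<union> end_nbhds adj"
  have opB: "openin (freudenthal adj) B"
    using B unfolding freudenthal_def by (rule topology_generated_by_Basis)
  have op_line: "open (line w -` B)" if "\<And>i. adj (w i) (w (i + 1))" for w
    using openin_continuous_map_preimage[OF G.continuous_line[of w] opB] that by (simp add: vimage_def)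
  have half: "open {z. \<tau> * Im z > 0 \<and> line w (Re z / \<bar>Im z\<bar>) \<in> B}"
    if w: "\<And>i. adj (w i) (w (i + 1))" for w and \<tau> :: real
  proof -
    have "continuous_on {z. \<tau> * Im z > 0} (\<lambda>z. Re z / \<bar>Im z\<bar>)"
      by (intro continuous_intros) auto
    moreover have "open {z. \<tau> * Im z > 0}" by (intro open_Collect_less continuous_intros)
    ultimately have "open ({z. \<tau> * Im z > 0} \<inter> (\<lambda>z. Re z / \<bar>Im z\<bar>) -` (line w -` B))"
      using continuous_open_preimage op_line[of w] w by blast
    thus ?thesis by (simp add: vimage_def Int_def)
  qed
  have "\<exists>T. open T \<and> z \<in> T \<and> T \<inter> unit_circle \<subseteq> wrap -` B" if z: "z \<in> unit_circle" "wrap z \<in> B" for z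
  proof (cases "Im z = 0")
    case True
    hence re: "(Re z)\<^sup>2 = 1" using z(1) unfolding circle_iff by simp
    define \<sigma> :: int where "\<sigma> = (if Re z > 0 then 1 else -1)"
    have \<sigma>: "\<sigma> = 1 \<or> \<sigma> = -1" and Rez: "Re z = of_int \<sigma>"
      using re by (auto simp: \<sigma>_def power2_eq_1_iff)
    have wz: "wrap z = EndPt (side \<sigma>)" using True by (simp add: wrap_def \<sigma>_def)
    have "B \<in> end_nbhds adj"
      using B z(2) unfolding wz edge_interval_nbhds_def vertex_star_nbhds_def by auto
    then obtain S \<omega> where S: "finite S" "B = end_nbhd adj S \<omega>" by (auto simp: end_nbhds_def)
    obtain N where N: "N \<ge> 0" "\<And>x. N < of_int \<sigma> * x \<Longrightarrow> line pv x \<in> B \<and> line qv x \<in> B"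
      using line_tail[OF \<sigma> S(1)] z(2) unfolding wz S(2) by blast
    show ?thesis
    proof (intro exI conjI)
      \<comment> \<open>This is the condition that the cotangent exceeds \<open>N\<close> towards
        the end, multiplied by \<open>\<bar>Im y\<bar>\<close>. In this form it is visibly open, and
        on the real axis it selects the correct one of the points 1 and -1.\<close>
      show "open {y. N * \<bar>Im y\<bar> < of_int \<sigma> * Re y}" by (intro open_Collect_less continuous_intros)
      show "z \<in> {y. N * \<bar>Im y\<bar> < of_int \<sigma> * Re y}" using True Rez \<sigma> by auto
      show "{y. N * \<bar>Im y\<bar> < of_int \<sigma> * Re y} \<inter> unit_circle \<subseteq> wrap -` B"
      proof
        fix y assume y: "y \<in> {y. N * \<bar>Im y\<bar> < of_int \<sigma> * Re y} \<inter> unit_circle"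
        show "y \<in> wrap -` B"
        proof (cases "Im y = 0")
          case True
          hence "wrap y = EndPt (side \<sigma>)" using y \<sigma> by (auto simp: wrap_def)
          thus ?thesis using z(2) wz by simp
        next
          case False
          hence "N < of_int \<sigma> * (Re y / \<bar>Im y\<bar>)" using y by (simp add: field_simps)
          thus ?thesis using N(2) False by (simp add: wrap_def)
        qed
      qed
    qed
  next
    case False
    show ?thesis
    proof (cases "Im z > 0")
      case True
      show ?thesis
        by (rule exI[of _ "{z. 1 * Im z > 0 \<and> line pv (Re z / \<bar>Im z\<bar>) \<in> B}"], intro conjI half)
           (use True z(2) adj_consecutive in \<open>auto simp: wrap_def\<close>)
    next
      case neg: False
      show ?thesis
        by (rule exI[of _ "{z. -1 * Im z > 0 \<and> line qv (Re z / \<bar>Im z\<bar>) \<in> B}"], intro conjI half)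
           (use neg False z(2) adj_consecutive in \<open>auto simp: wrap_def\<close>)
    qed
  qed
  hence "openin (top_of_set unit_circle) (wrap -` B \<inter> unit_circle)"
    by (subst openin_subopen) (metis (no_types, lifting) IntE IntI inf_commute inf_le1 le_inf_iff openin_open_Int vimageD)
  thus "openin (top_of_set unit_circle) (wrap -` B \<inter> topspace (top_of_set unit_circle))" by simp
next
  have "wrap z \<in> topspace (freudenthal adj)" for z
    using G.line_topspace adj_consecutive is_end_side by (auto simp: wrap_def)
  thus "wrap ` topspace (top_of_set unit_circle) \<subseteq> \<Union> (edge_interval_nbhds adj \<union> vertex_star_nbhds adj \<union> end_nbhds adj)"
    unfolding freudenthal_def topology_generated_by_topspace by blast
qed

lemma inj_pv: "inj pv" and inj_qv: "inj qv" by (auto simp: inj_def)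

lemma pv_qv_disjoint: "range pv \<inter> range qv = {}" by auto

lemma side_neq: "side 1 \<noteq> side (-1)"
proof
  assume eq: "side 1 = side (-1)"
  have r: "three_rays 1 0 \<in> side 1" using three_rays_side by simp
  hence "rays_equiv adj (three_rays 1 0) (three_rays 1 0)" using rays_equiv_refl by (auto simp: side_def)
  thus False using sides_not_equiv r eq by metis
qed

lemma unit_slope_unique:
  fixes a b c d :: real
  assumes "a / b = c / d" "b > 0" "d > 0" "a\<^sup>2 + b\<^sup>2 = 1" "c\<^sup>2 + d\<^sup>2 = 1"
  shows "a = c \<and> b = d"
proof -
  define k where "k = a / b"
  have a: "a = k * b" "c = k * d" using assms by (auto simp: k_def field_simps)
  have "b\<^sup>2 * (k\<^sup>2 + 1) = d\<^sup>2 * (k\<^sup>2 + 1)" using assms(4,5) a by (simp add: algebra_simps power_mult_distrib)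
  moreover have "k\<^sup>2 + 1 \<noteq> 0" by (metis add_nonneg_eq_0_iff zero_le_power2 zero_le_one zero_neq_one)
  ultimately have "b\<^sup>2 = d\<^sup>2" by simp
  hence "b = d" using assms(2,3) by (simp add: power2_eq_iff_nonneg)
  thus ?thesis using a by simp
qed

lemma inj_wrap: "inj_on wrap unit_circle"
proof (rule inj_onI)
  fix y z assume y: "y \<in> unit_circle" and z: "z \<in> unit_circle" and eq: "wrap y = wrap z"
  have n: "(Re y)\<^sup>2 + (Im y)\<^sup>2 = 1" "(Re z)\<^sup>2 + (Im z)\<^sup>2 = 1" using y z by (simp_all only: circle_iff)
  show "y = z"
  proof (cases "Im y = 0 \<or> Im z = 0")
    case True
    hence "Im y = 0" "Im z = 0" using eq line_neq_EndPt line_neq_EndPt[symmetric] by (auto simp: wrap_def split: if_splits)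
    moreover from this have "Re y = 1 \<or> Re y = -1" "Re z = 1 \<or> Re z = -1" using n by (auto simp: power2_eq_1_iff)
    ultimately show ?thesis using eq side_neq by (auto simp: wrap_def complex_eq_iff split: if_splits)
  next
    case False
    have s: "Im y > 0 \<longleftrightarrow> Im z > 0"
      using eq False line_disjoint[OF pv_qv_disjoint] line_disjoint[OF pv_qv_disjoint, symmetric]
      by (auto simp: wrap_def split: if_splits)
    hence "Re y / \<bar>Im y\<bar> = Re z / \<bar>Im z\<bar>"
    proof (cases "Im y > 0")
      case True
      hence "line pv (Re y / \<bar>Im y\<bar>) = line pv (Re z / \<bar>Im z\<bar>)" using eq s by (simp add: wrap_def)
      thus ?thesis by (rule line_inj[OF inj_pv])
    next
      case neg: False
      hence "line qv (Re y / \<bar>Im y\<bar>) = line qv (Re z / \<bar>Im z\<bar>)"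
        using eq s False unfolding wrap_def by (simp del: abs_if)
      thus ?thesis by (rule line_inj[OF inj_qv])
    qed
    hence "Re y = Re z \<and> \<bar>Im y\<bar> = \<bar>Im z\<bar>" using False n by (intro unit_slope_unique) auto
    thus ?thesis using s False by (auto simp: complex_eq_iff)
  qed
qed

lemma image_wrap:
  "wrap ` unit_circle = range (line pv) \<union> range (line qv) \<union> {EndPt (side 1), EndPt (side (-1))}"
proof
  show "wrap ` unit_circle \<subseteq> range (line pv) \<union> range (line qv) \<union> {EndPt (side 1), EndPt (side (-1))}"
    unfolding wrap_def by (auto split: if_splits)
  have "line pv x \<in> wrap ` unit_circle \<and> line qv x \<in> wrap ` unit_circle" for x
  proof -
    \<comment> \<open>The point of the upper half circle with cotangent \<open>x\<close> is
      \<open>(x/s, 1/s)\<close>.\<close>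
    define s where "s = sqrt (x\<^sup>2 + 1)"
    have s: "s > 0" "s\<^sup>2 = x\<^sup>2 + 1" by (auto simp: s_def add_nonneg_pos)
    have unit: "(x / s)\<^sup>2 + (1 / s)\<^sup>2 = 1" 
      using s by (simp add: power_divide add_divide_distrib[symmetric] sum_power2_eq_zero_iff[of x 1, simplified])
    have "wrap (Complex (x / s) (1 / s)) = line pv x" "wrap (Complex (x / s) (- (1 / s))) = line qv x"
      using s by (auto simp: wrap_def)
    moreover have "Complex (x / s) (1 / s) \<in> unit_circle" "Complex (x / s) (- (1 / s)) \<in> unit_circle"
      unfolding circle_iff using unit by simp_all
    ultimately show ?thesis by (metis imageI)
  qed
  moreover have "EndPt (side 1) = wrap 1" "EndPt (side (-1)) = wrap (-1)" "1 \<in> unit_circle" "-1 \<in> unit_circle"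
    by (auto simp: wrap_def)
  ultimately show "range (line pv) \<union> range (line qv) \<union> {EndPt (side 1), EndPt (side (-1))} \<subseteq> wrap ` unit_circle"
    by auto
qed

text \<open>A continuous injection of a compact space into a Hausdorff space is a homeomorphism onto
  its image.\<close>

lemma hamilton_wrap: "hamilton_circle adj (wrap ` unit_circle)"
  unfolding hamilton_circle_def
proof (intro conjI allI)
  show sub: "wrap ` unit_circle \<subseteq> topspace (freudenthal adj)"
    using continuous_map_image_subset_topspace[OF continuous_wrap] by simp
  have "homeomorphic_map (top_of_set unit_circle) (subtopology (freudenthal adj) (wrap ` unit_circle)) wrap"
  proof (rule continuous_imp_homeomorphic_map)
    show "continuous_map (top_of_set unit_circle) (subtopology (freudenthal adj) (wrap ` unit_circle)) wrap"
      using continuous_wrap by (simp add: continuous_map_in_subtopology)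
    show "compact_space (top_of_set unit_circle)" by (simp add: compact_space_subtopology)
    show "Hausdorff_space (subtopology (freudenthal adj) (wrap ` unit_circle))"
      using G.Hausdorff_freudenthal Hausdorff_space_subtopology by blast
    show "wrap ` topspace (top_of_set unit_circle) = topspace (subtopology (freudenthal adj) (wrap ` unit_circle))"
      using sub by auto
    show "inj_on wrap (topspace (top_of_set unit_circle))" using inj_wrap by simp
  qed
  thus "subtopology (freudenthal adj) (wrap ` unit_circle) homeomorphic_space top_of_set unit_circle"
    using homeomorphic_map_imp_homeomorphic_space homeomorphic_space_sym by blast
  fix v show "Vtx v \<in> wrap ` unit_circle"
    unfolding image_wrap
    by (cases v rule: vertex_cases) (auto simp: line_of_int[symmetric] simp del: line_of_int)
qed

section \<open>Uniqueness of the Hamilton circle\<close>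

lemma ham_closed:
  assumes "hamilton_circle adj H"
  shows "closedin (freudenthal adj) H"
proof -
  have sub: "H \<subseteq> topspace (freudenthal adj)" using assms by (simp add: hamilton_circle_def)
  have "compact_space (subtopology (freudenthal adj) H)"
    using assms homeomorphic_compact_space compact_space_subtopology[of euclidean unit_circle]
    unfolding hamilton_circle_def by (metis compactin_euclidean_iff compact_sphere)
  hence "compactin (freudenthal adj) H" using sub by (simp add: compactin_subspace)
  thus ?thesis using compactin_imp_closedin[OF G.Hausdorff_freudenthal] by blast
qed

lemma mid_in_ham:
  assumes ham: "hamilton_circle adj H" and uv: "adj u v"
  shows "mid (u, v) \<in> H \<longleftrightarrow>
    (\<exists>i. {u, v} = {pv i, pv (i + 1)}) \<or> (\<exists>i. {u, v} = {qv i, qv (i + 1)})"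
proof -
  have P: "mid (pv i, pv (i + 1)) \<in> H" and Q: "mid (qv i, qv (i + 1)) \<in> H" and M: "mid (qv i, mate i) \<notin> H" for i
    using all_forced[OF ham, of i] by (simp_all add: uses_P_def[OF ham] uses_Q_def[OF ham] uses_mate_def[OF ham])
  have P': "mid (pv i, pv (i - 1)) \<in> H" and Q': "mid (qv i, qv (i - 1)) \<in> H" for i
    using P[of "i - 1"] Q[of "i - 1"] by (simp_all add: mid_commute)
  show ?thesis
  proof (cases u rule: vertex_cases)
    case u: (P i)
    then consider "v = pv (i - 1)" | "v = pv (i + 1)" | "v = qv (9*i+4)" using uv by (auto simp: adj_pv)
    thus ?thesis
    proof cases
      case 1
      hence "{u, v} = {pv (i - 1), pv (i - 1 + 1)}" using u by auto
      thus ?thesis using P'[of i] u 1 by blast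
    next
      case 3
      thus ?thesis using M[of "9*i+4"] u by (auto simp: mid_commute doubleton_eq_iff)
    qed (use P u in auto)
  next
    case u: (Q i)
    then consider "v = qv (i - 1)" | "v = qv (i + 1)" | "v = mate i" using uv by (auto simp: adj_qv)
    thus ?thesis
    proof cases
      case 1
      hence "{u, v} = {qv (i - 1), qv (i - 1 + 1)}" using u by auto
      thus ?thesis using Q'[of i] u 1 by blast
    next
      case 3
      thus ?thesis using M[of i] u mate_cases[of i] by (auto simp: doubleton_eq_iff)
    qed (use Q u in auto)
  qed
qed

text \<open>Vertices agree by definition and edge points by \<open>mid_in_ham\<close>. That
  \<open>H\<close> contains both ends follows from closedness, because it contains the image of the
  circle off the real axis.\<close>

lemma ham_unique:
  assumes ham: "hamilton_circle adj H"
  shows "H = wrap ` unit_circle"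
proof -
  have V: "Vtx v \<in> H" for v using ham by (simp add: hamilton_circle_def)
  have sub: "H \<subseteq> topspace (freudenthal adj)" using ham by (simp add: hamilton_circle_def)
  have edge: "EPt u v t \<in> H \<longleftrightarrow> EPt u v t \<in> wrap ` unit_circle" if uv: "u < v" "adj u v" "0 < t" "t < 1" for u v t
  proof -
    have "EPt u v t \<in> H \<longleftrightarrow> mid (u, v) \<in> H"
      using G.ham_edge_all_or_none[OF ham uv(1,2), of t "1/2"] G.ham_edge_all_or_none[OF ham uv(1,2), of "1/2" t]
        uv(3,4) G.mid_simps(1)[OF uv(1)] by auto
    moreover have "EPt u v t \<in> wrap ` unit_circle \<longleftrightarrow>
        (\<exists>i. {u, v} = {pv i, pv (i + 1)}) \<or> (\<exists>i. {u, v} = {qv i, qv (i + 1)})"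
    proof -
      have "EPt u v t \<in> range (line w) \<longleftrightarrow> (\<exists>i. {u, v} = {w i, w (i + 1)})" for w
        unfolding doubleton_eq_iff using EPt_in_line[of u v t w] line_covers_edge[OF _ uv(1,3,4)] by blast
      thus ?thesis unfolding image_wrap by auto
    qed
    moreover have "mid (u, v) \<in> H \<longleftrightarrow>
        (\<exists>i. {u, v} = {pv i, pv (i + 1)}) \<or> (\<exists>i. {u, v} = {qv i, qv (i + 1)})"
      using ham uv(2) by (rule mid_in_ham)
    ultimately show ?thesis by blast
  qed
  have sub': "H \<subseteq> wrap ` unit_circle"
  proof
    fix p assume p: "p \<in> H"
    hence "p \<in> topspace (freudenthal adj)" using sub by blast
    thus "p \<in> wrap ` unit_circle"
      using p edge is_end_adj hamilton_wrap
      by (cases p) (auto simp: hamilton_circle_def image_wrap)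
  qed
  have inner: "wrap z \<in> H" if z: "z \<in> unit_circle" "Im z \<noteq> 0" for z
  proof (cases "wrap z")
    case (Vtx v) thus ?thesis using V by simp
  next
    case (EPt u v t)
    moreover have "wrap z \<in> topspace (freudenthal adj)" "wrap z \<in> wrap ` unit_circle"
      using z(1) hamilton_wrap by (auto simp: hamilton_circle_def)
    ultimately show ?thesis using edge by simp
  next
    case (EndPt \<omega>)
    thus ?thesis using z(2) line_neq_EndPt by (simp add: wrap_def)
  qed
  have "closedin (top_of_set unit_circle) {z \<in> topspace (top_of_set unit_circle). wrap z \<in> H}"
    using continuous_wrap ham_closed[OF ham] by (rule closedin_continuous_map_preimage)
  hence cl: "closed {z \<in> unit_circle. wrap z \<in> H}" using closedin_closed_eq[of unit_circle] by simp
  have "wrap z \<in> H" if z: "z \<in> unit_circle" for z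
  proof (cases "Im z = 0")
    case True
    hence re: "Re z = 1 \<or> Re z = -1" using z unfolding circle_iff by (simp add: power2_eq_1_iff)
    \<comment> \<open>Rotating by an angle between 0 and \<pi> leaves the real axis, so
      \<open>z\<close> is approached by points already known to be mapped into
      \<open>H\<close>.\<close>
    define s where "s n = z * cis (1 / real (Suc n))" for n
    have "(\<lambda>n. cis (1 / real (Suc n))) \<longlonglongrightarrow> cis 0"
      using LIMSEQ_inverse_real_of_nat by (intro tendsto_cis) (simp add: inverse_eq_divide)
    hence lim: "s \<longlonglongrightarrow> z" using tendsto_mult_left[of _ 1 sequentially z] by (simp add: s_def[abs_def])
    have "s n \<in> {z \<in> unit_circle. wrap z \<in> H}" for n
    proof -
      have "0 < 1 / real (Suc n)" "1 / real (Suc n) \<le> 1" by auto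
      hence "0 < 1 / real (Suc n)" "1 / real (Suc n) < pi" using pi_gt3 by linarith+
      hence "sin (1 / real (Suc n)) > 0" by (rule sin_gt_zero)
      hence "Im (s n) \<noteq> 0" using True re by (auto simp: s_def)
      moreover have "s n \<in> unit_circle" using z by (simp add: s_def norm_mult)
      ultimately show ?thesis using inner by simp
    qed
    from closed_sequentially[OF cl this lim] show ?thesis by simp
  qed (use inner z in blast)
  thus ?thesis using sub' by blast
qed

theorem theorem1p11:
  shows "\<exists>E :: nat \<Rightarrow> nat \<Rightarrow> bool.
    simple_graph E \<and> graph_connected E \<and>
    (\<forall>v. vdegree E v = 3) \<and>
    (\<forall>\<omega>. is_end E \<omega> \<longrightarrow> end_vertex_degree E \<omega> = 3 \<and> end_edge_degree E \<omega> = 3) \<and>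
    (\<exists>!H. hamilton_circle E H)"
proof (intro exI[of _ adj] conjI allI impI)
  show "simple_graph adj" "graph_connected adj" by (rule simple_adj graph_connected_adj)+
  show "vdegree adj v = 3" for v by (rule vdegree_adj)
  show "end_vertex_degree adj \<omega> = 3" "end_edge_degree adj \<omega> = 3" if "is_end adj \<omega>" for \<omega>
    using that end_degrees unfolding is_end_adj by auto
  show "\<exists>!H. hamilton_circle adj H" using hamilton_wrap ham_unique by blast
qed

end
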